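(* For $a\in(1/4,1/2)$ let $\chi(a)=\sup\{b : \mathcal J(a,b)\text{ is uncountable}\}$. Any $a\in(1/4,1/2)$ falls into one of the following four categories. (i) Let $n\ge1$, $r_1,\dots,r_n\in\mathbb Q\cap(0,1)$, $s_n=\rho_{r_1}\cdots\rho_{r_n}(0)$ and $t_n=\rho_{r_1}\cdots\rho_{r_n}(1)$. Then $\chi(a)=t_ns_n^\infty$ for all $a\in[s_n^\infty,s_nt_ns_n^\infty]$. Furthermore, $\chi(a)<t_ns_n^\infty$ for any $a<s_n^\infty$ and $\chi(a)>t_ns_n^\infty$ for any $a>s_nt_ns_n^\infty$, so this is an actual plateau of $\chi$. (ii) If $a\in\mathcal S$, then $\chi(a)=a+1/4$. (iii) If $a\in\mathcal S_n(r_1,\dots,r_{n-1})$ for some $n\ge2$ and $r_1,\dots,r_{n-1}\in\mathbb Q\cap(0,1)$, then $\chi(a)=a+(1-2^{-Q_{n-1}})(t_{n-1}-s_{n-1})$. (iv) If there exists $\boldsymbol r=(r_1,r_2,\dots)\in(\mathbb Q\cap(0,1))^{\mathbb N}$ such that $a\in\widetilde\Delta(r_1,\dots,r_n)$ for all $n\ge1$, then $a=\mathfrak s(\boldsymbol r)$ and $\chi(a)=\mathfrak t(\boldsymbol r)$.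
   Context: Doubling map: $T:[0,1]\to[0,1]$, $Tx=2x$ for $x\in[0,1/2]$, $Tx=2x-1$ for $x\in(1/2,1]$. For $0<a<b<1$ put $\mathcal J(a,b)=\{x\in[0,1]: T^nx\notin(a,b)\text{ for all }n\ge0\}$. Words have letters in $\{0,1\}$; concatenation is juxtaposition, $u^\infty=uuu\cdots$, $|u|$ is the length of $u$ and $|u|_1$ the number of 1s. An infinite word $w_1w_2\dots$ is identified with the real number $\pi(w)=\sum_{n\ge1}w_n2^{-n}$; in arithmetic expressions a finite word $w_1\dots w_m$ stands for $\sum_{n=1}^m w_n2^{-n}$. A word is balanced if any two of its factors $u,v$ of equal length satisfy $||u|_1-|v|_1|\le1$; a finite word $w$ is cyclically balanced if $w^2$ is balanced. For $r=p/q\in\mathbb Q\cap(0,1)$ in lowest terms, $\omega_r^-$ is the lexicographically largest cyclically balanced word of length $q$ with exactly $p$ ones beginning with 0, and $\omega_r^+$ is the lexicographically smallest cyclically balanced word of length $q$ with exactly $p$ ones beginning with 1. The substitution $\rho_r$ sends $0\mapsto\omega_r^-$, $1\mapsto\omega_r^+$ and extends to words by concatenation. For $r_1,\dots,r_n\in\mathbb Q\cap(0,1)$, $r_i=p_i/q_i$ in lowest terms, put $s_n=\rho_{r_1}\cdots\rho_{r_n}(0)$, $t_n=\rho_{r_1}\cdots\rho_{r_n}(1)$ (compositions), $Q_n=q_1\cdots q_n=|s_n|=|t_n|$, $$\Delta(r_1,\dots,r_n)=[s_n^\infty,s_nt_n^\infty],\qquad \widetilde\Delta(r_1,\dots,r_n)=[s_nt_ns_n^\infty,s_nt_n^\infty].$$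 Put $\mathcal S=(1/4,1/2)\setminus\bigcup_{r\in\mathbb Q\cap(0,1)}\Delta(r)$ and, for $n\ge2$, $\mathcal S_n(r_1,\dots,r_{n-1})=\widetilde\Delta(r_1,\dots,r_{n-1})\setminus\bigcup_{r_n\in\mathbb Q\cap(0,1)}\Delta(r_1,\dots,r_n)$. For $\boldsymbol r=(r_1,r_2,\dots)\in(\mathbb Q\cap(0,1))^{\mathbb N}$ put $\mathfrak s(\boldsymbol r)=\lim_n\rho_{r_1}\cdots\rho_{r_n}(0)$ and $\mathfrak t(\boldsymbol r)=\lim_n\rho_{r_1}\cdots\rho_{r_n}(1)$ (coordinatewise limits). *)

theory Defs
  imports
    "HOL-Analysis.Analysis"
    "HOL-Library.Sublist"
    "HOL-Library.List_Lexorder"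
    "HOL-Library.Stream"
begin

section \<open>The doubling map with a hole\<close>

definition doubling :: "real \<Rightarrow> real" where
  "doubling x = (if x \<le> 1/2 then 2 * x else 2 * x - 1)"

definition survivors :: "real \<Rightarrow> real \<Rightarrow> real set" where
  "survivors a b = {x \<in> {0..1}. \<forall>n::nat. (doubling ^^ n) x \<notin> {a<..<b}}"

definition chi :: "real \<Rightarrow> real" where
  "chi a = Sup {b. a < b \<and> b < 1 \<and> uncountable (survivors a b)}"

section \<open>Words\<close>

text \<open>The letters 0 and 1 are \<^term>\<open>False\<close> and \<^term>\<open>True\<close>. Finite words are lists and
  infinite words are streams, both indexed from 0; \<open>u\<^sup>\<infinity>\<close> is \<^term>\<open>cycle u\<close> (for nonempty \<open>u\<close>) and
  the concatenation of a finite word with an infinite one is \<^term>\<open>u @- w\<close>.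
  Finite words are ordered lexicographically.\<close>

definition val :: "bool stream \<Rightarrow> real" where
  "val w = (\<Sum>n. of_bool (w !! n) / 2 ^ (n + 1))"

definition fval :: "bool list \<Rightarrow> real" where
  "fval w = (\<Sum>n<length w. of_bool (w ! n) / 2 ^ (n + 1))"

abbreviation ones :: "bool list \<Rightarrow> nat" where
  "ones w \<equiv> count_list w True"

definition balanced :: "bool list \<Rightarrow> bool" where
  "balanced w \<longleftrightarrow> (\<forall>u v. sublist u w \<and> sublist v w \<and> length u = length v \<longrightarrow>
     \<bar>int (ones u) - int (ones v)\<bar> \<le> 1)"

definition cyclically_balanced :: "bool list \<Rightarrow> bool" where
  "cyclically_balanced w \<longleftrightarrow> balanced (w @ w)"

text \<open>The rationals of the open unit interval.\<close>

abbreviation unit_rats :: "rat set" where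
  "unit_rats \<equiv> {0<..<1}"

definition rat_num :: "rat \<Rightarrow> nat" where
  "rat_num r = nat (fst (quotient_of r))"

definition rat_den :: "rat \<Rightarrow> nat" where
  "rat_den r = nat (snd (quotient_of r))"

definition cyc_words :: "rat \<Rightarrow> bool list set" where
  "cyc_words r = {w. cyclically_balanced w \<and> length w = rat_den r \<and> ones w = rat_num r}"

definition omega_minus :: "rat \<Rightarrow> bool list" where
  "omega_minus r = Max {w \<in> cyc_words r. hd w = False}"

definition omega_plus :: "rat \<Rightarrow> bool list" where
  "omega_plus r = Min {w \<in> cyc_words r. hd w = True}"

definition rho :: "rat \<Rightarrow> bool list \<Rightarrow> bool list" where
  "rho r w = concat (map (\<lambda>c. if c then omega_plus r else omega_minus r) w)"

section \<open>Iterated substitutions and the associated intervals\<close>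

text \<open>For \<open>rs = [r\<^sub>1, \<dots>, r\<^sub>n]\<close>, \<^term>\<open>sw rs\<close> and \<^term>\<open>tw rs\<close> are the words \<open>s\<^sub>n\<close> and \<open>t\<^sub>n\<close>;
  the substitution for \<open>r\<^sub>1\<close> is applied last.\<close>

definition sw :: "rat list \<Rightarrow> bool list" where
  "sw rs = foldr rho rs [False]"

definition tw :: "rat list \<Rightarrow> bool list" where
  "tw rs = foldr rho rs [True]"

definition Qprod :: "rat list \<Rightarrow> nat" where
  "Qprod rs = prod_list (map rat_den rs)"

definition Delta :: "rat list \<Rightarrow> real set" where
  "Delta rs = {val (cycle (sw rs)) .. val (sw rs @- cycle (tw rs))}"

definition Delta_tilde :: "rat list \<Rightarrow> real set" where
  "Delta_tilde rs =
     {val (sw rs @- tw rs @- cycle (sw rs)) .. val (sw rs @- cycle (tw rs))}"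

definition S_base :: "real set" where
  "S_base = {1/4<..<1/2} - (\<Union>r\<in>unit_rats. Delta [r])"

text \<open>\<open>S_level [r\<^sub>1, \<dots>, r\<^sub>n\<^sub>-\<^sub>1]\<close> is the set \<open>\<S>\<^sub>n(r\<^sub>1, \<dots>, r\<^sub>n\<^sub>-\<^sub>1)\<close>, for \<open>n \<ge> 2\<close>.\<close>

definition S_level :: "rat list \<Rightarrow> real set" where
  "S_level rs = Delta_tilde rs - (\<Union>r\<in>unit_rats. Delta (rs @ [r]))"

text \<open>An infinite sequence \<open>(r\<^sub>1, r\<^sub>2, \<dots>)\<close> is a function with \<open>r 0 = r\<^sub>1\<close>.\<close>

definition initial :: "(nat \<Rightarrow> rat) \<Rightarrow> nat \<Rightarrow> rat list" where
  "initial r n = map r [0..<n]"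

text \<open>Coordinatewise limit of finite words of unbounded length, letters carrying the discrete
  topology. Reading beyond the end of a word concerns only finitely many \<open>n\<close> for each
  coordinate \<open>k\<close> when the lengths tend to infinity, and hence does not affect the limit.\<close>

definition word_lim :: "(nat \<Rightarrow> bool list) \<Rightarrow> bool stream" where
  "word_lim W = smap (\<lambda>k. lim (\<lambda>n. W n ! k)) nats"

definition s_lim :: "(nat \<Rightarrow> rat) \<Rightarrow> bool stream" where
  "s_lim r = word_lim (\<lambda>n. sw (initial r n))"

definition t_lim :: "(nat \<Rightarrow> rat) \<Rightarrow> bool stream" where
  "t_lim r = word_lim (\<lambda>n. tw (initial r n))"

end

theory Submission
  imports Defs
begin

text \<open>Counting ones, a cyclically balanced word of length \<open>q\<close> with \<open>p\<close> ones is a rotation word: its prefix of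
  length \<open>i\<close> has \<open>\<lfloor>(\<theta> + i p) / q\<rfloor>\<close> ones for some \<open>\<theta> < q\<close>. Hence \<open>\<omega>\<^sub>r\<^sup>-\<close> and \<open>\<omega>\<^sub>r\<^sup>+\<close> belong to \<open>\<theta> = q - p - 1\<close>
  and \<open>\<theta> = q - p\<close>. If every tail of a word starting with 0 is at most \<open>s t\<^sup>\<infinity>\<close> and every tail starting with 1
  is at least \<open>t s\<^sup>\<infinity>\<close>, where \<open>s = \<rho>\<^sub>r(0)\<close> and \<open>t = \<rho>\<^sub>r(1)\<close>, then the word is constant or has a tail in the image of
  \<open>\<rho>\<^sub>r\<close>: a tail between \<open>s\<^sup>\<infinity>\<close> and \<open>t\<^sup>\<infinity>\<close> splits into blocks \<open>s\<close>, \<open>t\<close>, and without such tails the number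
  of ones would drift away from the slope \<open>r\<close> in both directions. Conversely the image of \<open>\<rho>\<^sub>r\<close> has this
  property. By induction, survivor sets can be desubstituted: for \<open>a \<le> s\<^sub>n t\<^sub>n s\<^sub>n\<^sup>\<infinity>\<close> and \<open>b > t\<^sub>n s\<^sub>n\<^sup>\<infinity>\<close> only
  eventually periodic words survive, whereas uncountably many survive for \<open>a \<ge> s\<^sub>n t\<^sub>n\<^sup>\<infinity>\<close> and
  \<open>b = t\<^sub>n s\<^sub>n\<^sup>\<infinity>\<close>; letting \<open>r\<^sub>n\<close> increase to a given rational extends the latter to the whole plateau. The remaining
  values of \<open>\<chi>\<close> follow by monotonicity from neighbouring plateaus, except at the points
  \<open>s\<^sub>n t\<^sub>n\<^sup>\<infinity>\<close>, where \<open>\<chi>\<close> jumps to the right and \<open>b > t\<^sub>n s\<^sub>n t\<^sub>n\<^sup>\<infinity>\<close> is treated by desubstitution again.\<close>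

section \<open>Periodic words and the lexicographic order on infinite words\<close>

lemma snth_cycle: "w \<noteq> [] \<Longrightarrow> cycle w !! j = w ! (j mod length w)"
proof (induction j rule: less_induct)
  case (less j)
  have c: "cycle w = w @- cycle w" using less.prems by (rule cycle_decomp)
  show ?case
  proof (cases "j < length w")
    case True
    then show ?thesis using c by (metis shift_snth_less mod_less)
  next
    case False
    then have "cycle w !! j = cycle w !! (j - length w)"
      using c by (metis shift_snth_ge not_less)
    also have "\<dots> = w ! ((j - length w) mod length w)"
    proof (rule less.IH)
      show "j - length w < j" using less.prems False by (metis diff_less length_greater_0_conv not_less order.strict_trans2)
    qed (rule less.prems)
    finally show ?thesis using False by (simp add: le_mod_geq)
  qed
qed

lemma stream_eqI: "(\<And>n. u !! n = v !! n) \<Longrightarrow> u = v"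
  by (coinduction arbitrary: u v) (metis snth.simps)

definition slt :: "bool stream \<Rightarrow> bool stream \<Rightarrow> bool" where
  "slt u v \<longleftrightarrow> (\<exists>n. (\<forall>i<n. u !! i = v !! i) \<and> \<not> u !! n \<and> v !! n)"

definition sle :: "bool stream \<Rightarrow> bool stream \<Rightarrow> bool" where
  "sle u v \<longleftrightarrow> u = v \<or> slt u v"

lemma slt_linear: "u = v \<or> slt u v \<or> slt v u"
proof (cases "u = v")
  case False
  then have ex: "\<exists>n. u !! n \<noteq> v !! n" using stream_eqI by blast
  define n where "n = (LEAST n. u !! n \<noteq> v !! n)"
  have "u !! n \<noteq> v !! n" "\<forall>i<n. u !! i = v !! i"
    using LeastI_ex[OF ex] not_less_Least unfolding n_def by blast+
  then show ?thesis unfolding slt_def by metis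
qed simp

lemma slt_trans: assumes "slt u v" "slt v w" shows "slt u w"
proof -
  from assms obtain m n where
    m: "\<forall>i<m. u !! i = v !! i" "\<not> u !! m" "v !! m" and
    n: "\<forall>i<n. v !! i = w !! i" "\<not> v !! n" "w !! n"
    unfolding slt_def by blast
  have "m \<noteq> n" using m n by auto
  then have "(\<forall>i<min m n. u !! i = w !! i) \<and> \<not> u !! min m n \<and> w !! min m n"
    using m n by (auto simp: min_def)
  then show ?thesis unfolding slt_def by blast
qed

lemma slt_irrefl: "\<not> slt u u"
  by (auto simp: slt_def)

lemma sle_refl [simp]: "sle u u" by (simp add: sle_def)

lemma sle_trans: "sle u v \<Longrightarrow> sle v w \<Longrightarrow> sle u w"
  unfolding sle_def using slt_trans[of u v w] by auto

lemma not_sle_iff: "\<not> sle u v \<longleftrightarrow> slt v u"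
proof
  assume "\<not> sle u v" then show "slt v u" using slt_linear[of u v] by (auto simp: sle_def)
next
  assume *: "slt v u"
  show "\<not> sle u v"
  proof
    assume "sle u v"
    then have "slt u u" using * slt_trans[of u v u] by (auto simp: sle_def)
    then show False using slt_irrefl by simp
  qed
qed

lemma slt_first: "\<not> u !! 0 \<Longrightarrow> v !! 0 \<Longrightarrow> slt u v"
  unfolding slt_def by (intro exI[of _ 0]) auto

lemma slt_Cons: "slt (c ## u) (d ## v) \<longleftrightarrow> (\<not> c \<and> d) \<or> (c = d \<and> slt u v)" (is "?L = ?R")
proof
  assume ?L
  then obtain n where n: "\<forall>i<n. (c ## u) !! i = (d ## v) !! i" "\<not> (c ## u) !! n" "(d ## v) !! n"
    unfolding slt_def by blast
  show ?R
  proof (cases n)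
    case 0 then show ?thesis using n by auto
  next
    case (Suc m)
    have "c = d" using n(1)[rule_format, of 0] Suc by simp
    moreover have "slt u v" unfolding slt_def
    proof (intro exI[of _ m] conjI allI impI)
      fix i assume "i < m"
      then show "u !! i = v !! i" using n(1)[rule_format, of "Suc i"] Suc by simp
    qed (use n Suc in auto)
    ultimately show ?thesis by simp
  qed
next
  assume ?R
  then show ?L
  proof
    assume "\<not> c \<and> d" then show ?L by (intro slt_first) auto
  next
    assume *: "c = d \<and> slt u v"
    then obtain n where n: "\<forall>i<n. u !! i = v !! i" "\<not> u !! n" "v !! n"
      unfolding slt_def by blast
    have "\<forall>i<Suc n. (c ## u) !! i = (d ## v) !! i"
      using n(1) * by (auto simp: less_Suc_eq_0_disj)
    then show ?L unfolding slt_def using n by (intro exI[of _ "Suc n"]) auto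
  qed
qed

lemma sle_Cons: "sle (c ## u) (d ## v) \<longleftrightarrow> (\<not> c \<and> d) \<or> (c = d \<and> sle u v)"
  by (auto simp: sle_def slt_Cons)

lemma slt_shift [simp]: "slt (w @- u) (w @- v) \<longleftrightarrow> slt u v"
  by (induction w) (auto simp: slt_Cons)

lemma sle_shift [simp]: "sle (w @- u) (w @- v) \<longleftrightarrow> sle u v"
  by (induction w) (auto simp: sle_Cons)

text \<open>A word squeezed between two words with a common prefix has that prefix too; this is how
  blocks are read off in \<open>between_imp_sub\<close>.\<close>

lemma sle_shift_between:
  assumes "sle (w @- x) z" "sle z (w @- y)"
  obtains z' where "z = w @- z'" "sle x z'" "sle z' y"
proof -
  have "\<exists>z'. z = w @- z' \<and> sle x z' \<and> sle z' y"
    using assms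
  proof (induction w arbitrary: z)
    case (Cons c w)
    obtain d z1 where z: "z = d ## z1" by (cases z)
    from Cons.prems have "d = c \<and> sle (w @- x) z1 \<and> sle z1 (w @- y)"
      by (auto simp: z sle_Cons)
    then show ?case using Cons.IH z by fastforce
  qed simp
  then show ?thesis using that by blast
qed

section \<open>Constant words, the extremes of the order\<close>

definition constw :: "bool \<Rightarrow> bool stream" where
  "constw c = sconst c"

lemma constw_unfold: "constw c = c ## constw c"
  unfolding constw_def by (rule stream.expand) simp

lemma snth_constw [simp]: "constw c !! n = c"
  unfolding constw_def by simp

lemma constw_sel [simp]: "shd (constw c) = c" "stl (constw c) = constw c"
  unfolding constw_def by simp_all

lemma sdrop_constw [simp]: "sdrop n (constw c) = constw c"
  unfolding constw_def by simp

lemma constw_least: "sle (constw False) u"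
  by (rule ccontr) (auto simp: not_sle_iff slt_def)

lemma constw_greatest: "sle u (constw True)"
  by (rule ccontr) (auto simp: not_sle_iff slt_def)

section \<open>Counting ones\<close>

definition cnt :: "bool stream \<Rightarrow> nat \<Rightarrow> int" where
  "cnt u n = (\<Sum>i<n. of_bool (u !! i))"

lemma cnt_0 [simp]: "cnt u 0 = 0" by (simp add: cnt_def)

lemma cnt_Suc: "cnt u (Suc n) = cnt u n + of_bool (u !! n)"
  by (simp add: cnt_def)

lemma cnt_cong: "(\<And>i. i < n \<Longrightarrow> u !! i = v !! i) \<Longrightarrow> cnt u n = cnt v n"
  by (simp add: cnt_def)

lemma cnt_sdrop: "cnt u (m + n) = cnt u m + cnt (sdrop m u) n"
  by (induction n) (auto simp: cnt_Suc sdrop_snth add.commute)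

lemma cnt_Stream: "cnt (c ## u) (Suc n) = of_bool c + cnt u n"
  using cnt_sdrop[of "c ## u" 1 n] by (simp add: cnt_Suc)

lemma eq_by_cnt: "(\<And>i. cnt u i = cnt v i) \<Longrightarrow> u = v"
proof (rule stream_eqI)
  fix n assume "\<And>i. cnt u i = cnt v i"
  then have "cnt u (Suc n) - cnt u n = cnt v (Suc n) - cnt v n" by simp
  then show "u !! n = v !! n" by (auto simp: cnt_Suc split: if_splits)
qed

text \<open>At a first difference in the wrong direction the counts agree before it and
  \<open>u\<close> is ahead by one after it. This turns comparisons of balanced words into
  inequalities between integer parts.\<close>

lemma sle_by_cnt:
  assumes "\<And>i. cnt u i \<le> cnt v i" shows "sle u v"
proof (rule ccontr)
  assume "\<not> sle u v"
  then obtain n where n: "\<forall>i<n. v !! i = u !! i" "\<not> v !! n" "u !! n"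
    unfolding not_sle_iff slt_def by blast
  then have "cnt v n = cnt u n" by (intro cnt_cong) auto
  then show False using assms[of "Suc n"] n by (simp add: cnt_Suc)
qed

lemma cnt_shift: "cnt (w @- u) (length w + i) = int (ones w) + cnt u i"
  by (induction w) (auto simp: cnt_Stream)

lemma cnt_shift_take: "i \<le> length w \<Longrightarrow> cnt (w @- u) i = int (ones (take i w))"
proof (induction w arbitrary: i)
  case (Cons c w)
  then show ?case by (cases i) (auto simp: cnt_Stream)
qed simp

section \<open>Values of infinite words\<close>

lemma val_summable: "summable (\<lambda>n. of_bool (w !! n) / 2 ^ (n + 1) :: real)"
proof (rule summable_comparison_test')
  show "summable (\<lambda>n. (1/2) ^ (n + 1) :: real)"
    using summable_mult[OF summable_geometric[of "1/2::real"], of "1/2"] by simp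
qed (auto simp: power_divide)

lemma val_Stream: "val (c ## w) = of_bool c / 2 + val w / 2"
proof -
  have "val (c ## w) = of_bool c / 2 + (\<Sum>n. of_bool (w !! n) / 2 ^ (n + 1) / 2)"
    unfolding val_def using suminf_split_head[OF val_summable[of "c ## w"]]
    by (simp add: field_simps)
  also have "(\<Sum>n. of_bool (w !! n) / 2 ^ (n + 1) / 2 :: real) = val w / 2"
    unfolding val_def by (rule suminf_divide[OF val_summable])
  finally show ?thesis .
qed

lemma val_constw [simp]: "val (constw c) = of_bool c"
  using arg_cong[OF constw_unfold[of c], of val] by (simp add: val_Stream)

lemma val_nonneg: "0 \<le> val w"
  unfolding val_def by (rule suminf_nonneg[OF val_summable]) auto

lemma val_le_1: "val w \<le> 1"
proof -
  have "val w \<le> (\<Sum>n. (1/2) ^ Suc n :: real)"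
    unfolding val_def using val_summable
  proof (rule suminf_le[rotated])
    show "summable (\<lambda>n. (1/2) ^ Suc n :: real)"
      using power_half_series sums_summable by blast
  qed (auto simp: power_divide)
  then show ?thesis using power_half_series sums_unique by force
qed

lemma fval_Nil [simp]: "fval [] = 0" by (simp add: fval_def)

lemma fval_Cons: "fval (c # w) = of_bool c / 2 + fval w / 2"
  by (simp add: fval_def sum.lessThan_Suc_shift sum_divide_distrib del: sum.lessThan_Suc)

lemma val_shift: "val (w @- u) = fval w + val u / 2 ^ length w"
  by (induction w) (auto simp: val_Stream fval_Cons field_simps)

lemma val_close:
  assumes "stake k u = stake k v" shows "\<bar>val u - val v\<bar> \<le> 1 / 2 ^ k"
proof -
  have u: "val u = fval (stake k u) + val (sdrop k u) / 2 ^ k"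
    using val_shift[of "stake k u" "sdrop k u"] by (simp only: stake_sdrop length_stake)
  have v: "val v = fval (stake k v) + val (sdrop k v) / 2 ^ k"
    using val_shift[of "stake k v" "sdrop k v"] by (simp only: stake_sdrop length_stake)
  have "val u - val v = (val (sdrop k u) - val (sdrop k v)) / 2 ^ k"
    using u v assms by (simp add: diff_divide_distrib)
  moreover have "\<bar>val (sdrop k u) - val (sdrop k v)\<bar> \<le> 1"
    using val_nonneg[of "sdrop k u"] val_nonneg[of "sdrop k v"] val_le_1[of "sdrop k u"]
      val_le_1[of "sdrop k v"] by linarith
  ultimately show ?thesis by (simp add: divide_right_mono)
qed

lemma val_pos: "w !! n \<Longrightarrow> 0 < val w"
proof (induction n arbitrary: w)
  case 0
  then show ?case using val_nonneg[of "stl w"] by (cases w) (auto simp: val_Stream)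
next
  case (Suc n)
  then show ?case by (cases w) (fastforce simp: val_Stream)
qed

lemma val_less_1: "\<not> w !! n \<Longrightarrow> val w < 1"
proof (induction n arbitrary: w)
  case 0
  then show ?case using val_le_1[of "stl w"] by (cases w) (auto simp: val_Stream)
next
  case (Suc n)
  then show ?case by (cases w) (fastforce simp: val_Stream)
qed

lemma slt_val_split:
  assumes "slt u v"
  obtains w u' v' where "u = w @- (False ## u')" "v = w @- (True ## v')"
proof -
  from assms obtain n where n: "\<forall>i<n. u !! i = v !! i" "\<not> u !! n" "v !! n"
    unfolding slt_def by blast
  have eq: "stake n u = stake n v" using n(1) by (intro nth_equalityI) auto
  have "u = stake n u @- (False ## sdrop (Suc n) u)"
    using n(2) by (metis id_stake_snth_sdrop)
  moreover have "v = stake n u @- (True ## sdrop (Suc n) v)"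
    using n(3) eq by (metis id_stake_snth_sdrop)
  ultimately show ?thesis using that by blast
qed

lemma slt_val_le: assumes "slt u v" shows "val u \<le> val v"
proof -
  obtain w u' v' where *: "u = w @- (False ## u')" "v = w @- (True ## v')"
    using slt_val_split[OF assms] .
  have "val u' \<le> 1 + val v'" using val_le_1[of u'] val_nonneg[of v'] by linarith
  then have "val (False ## u') \<le> val (True ## v')" by (simp add: val_Stream)
  then show ?thesis unfolding * val_shift by (simp add: divide_right_mono)
qed

lemma sle_val_le: "sle u v \<Longrightarrow> val u \<le> val v"
  using slt_val_le sle_def by auto

lemma val_less_slt: "val u < val v \<Longrightarrow> slt u v"
  using sle_val_le[of v u] not_sle_iff[of v u] by auto

text \<open>A word ending in \<open>10\<^sup>\<infinity>\<close> has the value of one ending in \<open>01\<^sup>\<infinity>\<close>; strict inequalities need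
  that one of these cases is excluded.\<close>

lemma slt_val_less:
  assumes "slt u v" "(\<forall>n. \<exists>m\<ge>n. \<not> u !! m) \<or> (\<forall>n. \<exists>m\<ge>n. v !! m)"
  shows "val u < val v"
proof -
  obtain w u' v' where *: "u = w @- (False ## u')" "v = w @- (True ## v')"
    using slt_val_split[OF assms(1)] .
  have "val u' < 1 \<or> 0 < val v'" using assms(2)
  proof
    assume "\<forall>n. \<exists>m\<ge>n. \<not> u !! m"
    then obtain m where m: "m \<ge> Suc (length w)" "\<not> u !! m" by blast
    then have "\<not> u' !! (m - Suc (length w))"
      by (auto simp: * Suc_le_eq simp flip: Suc_diff_Suc)
    then show ?thesis using val_less_1 by blast
  next
    assume "\<forall>n. \<exists>m\<ge>n. v !! m"
    then obtain m where m: "m \<ge> Suc (length w)" "v !! m" by blast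
    then have "v' !! (m - Suc (length w))"
      by (auto simp: * Suc_le_eq simp flip: Suc_diff_Suc)
    then show ?thesis using val_pos by blast
  qed
  then have "val u' < 1 + val v'" using val_le_1[of u'] val_nonneg[of v'] by linarith
  then have "val (False ## u') < val (True ## v')" by (simp add: val_Stream)
  then show ?thesis unfolding * val_shift by (simp add: divide_strict_right_mono)
qed

section \<open>Substitutions of constant length\<close>

definition sb :: "bool list \<Rightarrow> bool list \<Rightarrow> bool list \<Rightarrow> bool list" where
  "sb u v w = concat (map (\<lambda>c. if c then v else u) w)"

text \<open>Position \<open>j\<close> lies in block number \<open>j div length u\<close> at offset
  \<open>j mod length u\<close>, provided that both blocks have the same positive length; the
  formula then describes the concatenation of the blocks.\<close>

definition sbl :: "bool list \<Rightarrow> bool list \<Rightarrow> bool stream \<Rightarrow> bool stream" where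
  "sbl u v x = smap (\<lambda>j. (if x !! (j div length u) then v else u) ! (j mod length u)) nats"

text \<open>Equal lengths make block positions independent of the source word. The first letters 0
  and 1 let each source letter be recovered from its block and make the substitution strictly
  increasing.\<close>

definition blk :: "bool list \<Rightarrow> bool list \<Rightarrow> bool" where
  "blk u v \<longleftrightarrow> length u = length v \<and> u \<noteq> [] \<and> \<not> hd u \<and> hd v"

lemma sb_simps [simp]: "sb u v [] = []" "sb u v (c # w) = (if c then v else u) @ sb u v w"
  by (auto simp: sb_def)

lemma snth_sbl: "sbl u v x !! j = (if x !! (j div length u) then v else u) ! (j mod length u)"
  by (simp add: sbl_def)

lemma blkD: assumes "blk u v"
  shows "length v = length u" "0 < length u" "\<not> u ! 0" "v ! 0"
  using assms by (cases u; cases v; auto simp: blk_def)+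

lemma sbl_Stream:
  assumes "blk u v" shows "sbl u v (c ## x) = (if c then v else u) @- sbl u v x"
proof (rule stream_eqI)
  fix j
  note b = blkD[OF assms]
  show "sbl u v (c ## x) !! j = ((if c then v else u) @- sbl u v x) !! j"
  proof (cases "j < length u")
    case True
    then show ?thesis using b by (simp add: snth_sbl)
  next
    case False
    then have "j div length u = Suc ((j - length u) div length u)"
      "j mod length u = (j - length u) mod length u"
      using b(2) by (auto simp: le_div_geq le_mod_geq)
    then show ?thesis using False b by (simp add: snth_sbl)
  qed
qed

lemma sbl_shift: "blk u v \<Longrightarrow> sbl u v (w @- x) = sb u v w @- sbl u v x"
  by (induction w) (auto simp: sbl_Stream)

lemma snth_sbl_mult: "blk u v \<Longrightarrow> sbl u v x !! (k * length u) = x !! k"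
  using blkD[of u v] by (simp add: snth_sbl)

lemma sdrop_sbl:
  assumes "blk u v" shows "sdrop (k * length u) (sbl u v x) = sbl u v (sdrop k x)"
  using blkD(2)[OF assms] by (intro stream_eqI) (simp add: snth_sbl sdrop_snth add.commute)

lemma length_sb: "blk u v \<Longrightarrow> length (sb u v w) = length w * length u"
  by (induction w) (auto dest: blkD)

text \<open>The first difference 0 against 1 becomes a block \<open>u\<close> against a block
  \<open>v\<close>, and these differ already in their first letters.\<close>

lemma slt_sbl:
  assumes b: "blk u v" and "slt x y" shows "slt (sbl u v x) (sbl u v y)"
proof -
  obtain w x' y' where *: "x = w @- (False ## x')" "y = w @- (True ## y')"
    using slt_val_split[OF assms(2)] .
  have "slt (u @- sbl u v x') (v @- sbl u v y')"
    using b by (intro slt_first) (auto simp: blk_def)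
  then show ?thesis using b by (simp add: * sbl_shift sbl_Stream)
qed

lemma sle_sbl: "blk u v \<Longrightarrow> sle x y \<Longrightarrow> sle (sbl u v x) (sbl u v y)"
  using slt_sbl by (auto simp: sle_def)

lemma sle_sbl_iff: "blk u v \<Longrightarrow> sle (sbl u v x) (sbl u v y) \<longleftrightarrow> sle x y"
  using sle_sbl slt_sbl by (metis not_sle_iff)

lemma slt_sbl_iff: "blk u v \<Longrightarrow> slt (sbl u v x) (sbl u v y) \<longleftrightarrow> slt x y"
  using sle_sbl_iff not_sle_iff by metis

lemma sbl_constw:
  assumes "blk u v" shows "sbl u v (constw c) = cycle (if c then v else u)"
proof (rule stream_eqI)
  fix n
  have "u \<noteq> []" "v \<noteq> []" "length v = length u" using assms by (auto simp: blk_def)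
  then show "sbl u v (constw c) !! n = cycle (if c then v else u) !! n"
    by (cases c) (simp_all add: snth_sbl snth_cycle)
qed

lemma blk_sb:
  assumes "blk u v" "blk u' v'" shows "blk (sb u v u') (sb u v v')"
proof -
  obtain x y where xy: "u' = False # x" "v' = True # y"
    using assms(2) by (cases u'; cases v') (auto simp: blk_def)
  show ?thesis using assms xy length_sb[OF assms(1)] unfolding blk_def by (auto simp: hd_append)
qed

lemma sb_append: "sb u v (w @ w') = sb u v w @ sb u v w'"
  by (simp add: sb_def)

lemma sb_sb: "sb u v (sb u' v' w) = sb (sb u v u') (sb u v v') w"
  by (induction w) (auto simp: sb_append)

lemma nth_sb: "blk u v \<Longrightarrow> j < length w * length u \<Longrightarrow>
   sb u v w ! j = (if w ! (j div length u) then v else u) ! (j mod length u)"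
proof -
  assume a: "blk u v" "j < length w * length u"
  have "sb u v w ! j = sbl u v (w @- constw False) !! j"
    using a by (simp add: sbl_shift length_sb)
  moreover have "j div length u < length w"
    using a(2) by (simp add: less_mult_imp_div_less)
  ultimately show ?thesis by (simp add: snth_sbl)
qed

lemma sbl_sbl:
  assumes b: "blk u v" "blk u' v'"
  shows "sbl u v (sbl u' v' x) = sbl (sb u v u') (sb u v v') x"
proof (rule stream_eqI)
  fix j
  define q q' where "q = length u" and "q' = length u'"
  have q: "q > 0" "q' > 0" using b blkD by (auto simp: q_def q'_def)
  have m: "j mod (q' * q) div q = j div q mod q'" "j mod (q' * q) mod q = j mod q"
    using mod_mult2_eq[of j q q'] q by (auto simp: mult.commute)
  have l: "j mod (q' * q) < q' * q" using q by simp
  have "sbl (sb u v u') (sb u v v') x !! j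
      = sb u v (if x !! (j div (q' * q)) then v' else u') ! (j mod (q' * q))"
    using b by (simp add: snth_sbl length_sb q_def q'_def)
  also have "\<dots> = (if (if x !! (j div (q' * q)) then v' else u') ! (j div q mod q') then v else u)
       ! (j mod q)"
    using b l blkD(1)[OF b(2)] by (subst nth_sb) (auto simp: m q_def[symmetric] q'_def[symmetric])
  also have "j div (q' * q) = j div q div q'" by (simp add: div_mult2_eq[symmetric] mult.commute)
  finally show "sbl u v (sbl u' v' x) !! j = sbl (sb u v u') (sb u v v') x !! j"
    by (simp add: snth_sbl q_def q'_def)
qed

text \<open>Once both letters occur in both blocks, no image ends in \<open>0^inf\<close> or
  \<open>1^inf\<close>, the words whose values may have a second expansion.\<close>

lemma sbl_infinitely_many:
  assumes "blk u v" "c \<in> set u" "c \<in> set v" shows "\<exists>m\<ge>n. sbl u v x !! m = c"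
proof -
  define w where "w = (if x !! n then v else u)"
  have w: "c \<in> set w" "length w = length u" using assms blkD by (auto simp: w_def)
  then obtain i where i: "i < length u" "w ! i = c" by (metis in_set_conv_nth)
  have div_eq: "(n * length u + j) div length u = n" if "j < length u" for j
    using that by (metis add.commute add_cancel_left_right add_eq_0_iff_both_eq_0 bot_nat_0.not_eq_extremum div_less div_mult_self3 not_less_zero)
  have "sbl u v x !! (n * length u + i) = c"
    using i(2) by (simp add: snth_sbl w_def div_eq[OF i(1)] i(1))
  moreover have "n * length u + i \<ge> n" using blkD(2)[OF assms(1)]
    by (cases "length u") (auto intro: trans_le_add1)
  ultimately show ?thesis by blast
qed

section \<open>Itineraries of the doubling map\<close>

text \<open>The point 1/2 gets the letter 0, in accordance with the branches of
  \<open>doubling\<close>; so a dyadic rational in (0,1] gets its expansion ending in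
  \<open>1^inf\<close>.\<close>

definition itin :: "real \<Rightarrow> bool stream" where
  "itin x = smap (\<lambda>n. (doubling ^^ n) x > 1/2) nats"

lemma sdrop_itin: "sdrop n (itin x) = itin ((doubling ^^ n) x)"
  by (intro stream_eqI) (simp add: itin_def sdrop_snth funpow_add add.commute)

lemma itin_unfold: "itin x = (x > 1/2) ## itin (doubling x)"
  using sdrop_itin[of 1 x] by (intro stream.expand) (simp add: itin_def)

lemma doubling_mem: "x \<in> {0..1} \<Longrightarrow> doubling x \<in> {0..1}"
  by (auto simp: doubling_def)

lemma doubling_pow_mem: "x \<in> {0..1} \<Longrightarrow> (doubling ^^ n) x \<in> {0..1}"
  by (induction n) (use doubling_mem in auto)

text \<open>The error \<open>x - val (itin x)\<close> doubles under \<open>doubling\<close> yet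
  never exceeds 1 in absolute value, so it is 0.\<close>

lemma val_itin: assumes "x \<in> {0..1}" shows "val (itin x) = x"
proof -
  have *: "\<bar>x - val (itin x)\<bar> \<le> 1 / 2 ^ n" if "x \<in> {0..1}" for n x
    using that
  proof (induction n arbitrary: x)
    case 0
    then show ?case using val_nonneg[of "itin x"] val_le_1[of "itin x"] by auto
  next
    case (Suc n)
    have "\<bar>doubling x - val (itin (doubling x))\<bar> \<le> 1 / 2 ^ n"
      using Suc doubling_mem by blast
    moreover have "x - val (itin x) = (doubling x - val (itin (doubling x))) / 2"
      by (subst itin_unfold) (auto simp: val_Stream doubling_def field_simps)
    then have "\<bar>x - val (itin x)\<bar> = \<bar>doubling x - val (itin (doubling x))\<bar> / 2" by (simp add: abs_if field_simps)
    ultimately show ?case by (simp add: divide_le_eq mult.commute)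
  qed
  have "(\<lambda>n. 1 / 2 ^ n :: real) \<longlonglongrightarrow> 0"
    using LIMSEQ_power_zero[of "1/2::real"] by (simp add: power_divide)
  then have "\<bar>x - val (itin x)\<bar> \<le> 0"
    by (rule LIMSEQ_le_const) (use *[OF assms] in auto)
  then show ?thesis by simp
qed

text \<open>A later 1 is required because the word \<open>10^inf\<close> has value 1/2, which
  \<open>doubling\<close> sends to 1 and not to 0.\<close>

lemma doubling_val:
  assumes "\<exists>n. stl w !! n" shows "doubling (val w) = val (stl w)"
proof -
  obtain c u where w: "w = c ## u" by (cases w)
  obtain n where "u !! n" using assms w by auto
  then have "val u > 0" "val u \<le> 1" using val_pos val_le_1 by blast+
  then show ?thesis by (auto simp: w val_Stream doubling_def)
qed

lemma doubling_pow_val: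
  assumes "\<And>n. \<exists>m\<ge>n. w !! m" shows "(doubling ^^ n) (val w) = val (sdrop n w)"
proof (induction n)
  case (Suc n)
  have stl: "stl (sdrop n w) = sdrop (Suc n) w" using sdrop_stl[of n w] by simp
  obtain m where "m \<ge> Suc n" "w !! m" using assms by blast
  then have "sdrop (Suc n) w !! (m - Suc n)" by (simp add: sdrop_snth del: sdrop.simps)
  then have "doubling (val (sdrop n w)) = val (sdrop (Suc n) w)"
    using doubling_val[of "sdrop n w"] unfolding stl by blast
  then show ?case using Suc by (simp del: sdrop.simps)
qed simp

section \<open>Eventually periodic words and countable survivor sets\<close>

definition evper :: "bool stream \<Rightarrow> bool" where
  "evper z \<longleftrightarrow> (\<exists>n m. m > 0 \<and> sdrop (n + m) z = sdrop n z)"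

lemma evper_sdrop: assumes "evper (sdrop k z)" shows "evper z"
proof -
  obtain n m where "m > 0" "sdrop (n + m) (sdrop k z) = sdrop n (sdrop k z)"
    using assms unfolding evper_def by blast
  then have "m > 0 \<and> sdrop ((k + n) + m) z = sdrop (k + n) z"
    by (simp add: add.assoc)
  then show ?thesis unfolding evper_def by blast
qed

lemma evper_constw: "evper (constw c)"
  unfolding evper_def by (intro exI[of _ 0] exI[of _ 1]) simp

lemma evper_sbl: assumes "blk u v" "evper x" shows "evper (sbl u v x)"
proof -
  obtain n m where "m > 0" "sdrop (n + m) x = sdrop n x"
    using assms unfolding evper_def by blast
  then have "m * length u > 0 \<and>
     sdrop (n * length u + m * length u) (sbl u v x) = sdrop (n * length u) (sbl u v x)"
    using sdrop_sbl[OF assms(1), of "n + m" x] sdrop_sbl[OF assms(1), of n x] blkD(2)[OF assms(1)]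
    by (simp add: add_mult_distrib)
  then show ?thesis unfolding evper_def by blast
qed

lemma countable_evper: "countable {z. evper z}"
proof (rule countable_subset)
  show "{z. evper z} \<subseteq> (\<lambda>(a, b). a @- cycle b) ` UNIV"
  proof
    fix z assume "z \<in> {z. evper z}"
    then obtain n m where m: "m > 0" "sdrop (n + m) z = sdrop n z"
      unfolding evper_def by blast
    define y where "y = sdrop n z"
    have y: "y = stake m y @- y"
    proof -
      have "sdrop m y = y" using m(2) by (simp add: y_def)
      then show ?thesis using stake_sdrop[of m y] by simp
    qed
    define b where "b = stake m y"
    have b: "b \<noteq> []" "length b = m" using m by (auto simp: b_def)
    have per: "y !! j = b ! (j mod m)" for j
    proof (induction j rule: less_induct)
      case (less j)
      show ?case
      proof (cases "j < m")
        case True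
        then show ?thesis by (simp add: b_def)
      next
        case False
        then have "y !! j = y !! (j - m)"
          by (subst y) (simp add: b_def[symmetric] b)
        then show ?thesis using less[of "j - m"] False m(1) by (simp add: le_mod_geq)
      qed
    qed
    have "y = cycle b" by (intro stream_eqI) (simp add: per snth_cycle b)
    then have "z = stake n z @- cycle b" using stake_sdrop[of n z] by (simp only: y_def)
    then show "z \<in> (\<lambda>(a, b). a @- cycle b) ` UNIV" by (intro image_eqI[where x = "(stake n z, b)"]) auto
  qed
qed simp

text \<open>Passes from words to points. A tail of a survivor's itinerary has value at most
  \<open>a\<close> if it starts with 0 and at least \<open>b\<close> if it starts with 1. The
  infinitely many zeros of \<open>A\<close> turn the bound on values into one on words; the gap
  \<open>val B < b\<close> gives the strict bound by \<open>B\<close>.\<close>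

lemma countable_survivors:
  assumes AB: "\<And>z. \<lbrakk>\<And>n. \<not> z !! n \<Longrightarrow> sle (sdrop n z) A; \<And>n. z !! n \<Longrightarrow> slt B (sdrop n z)\<rbrakk> \<Longrightarrow> evper z"
    and A: "\<And>n. \<exists>m\<ge>n. \<not> A !! m" and "a \<le> val A" "a < 1/2" "val B < b" and B: "B !! 0"
  shows "countable (survivors a b)"
proof (rule countable_subset)
  have B2: "1/2 \<le> val B" using B val_nonneg by (cases B) (auto simp: val_Stream)
  show "survivors a b \<subseteq> val ` {z. evper z}"
  proof
    fix x assume x: "x \<in> survivors a b"
    then have x1: "x \<in> {0..1}" by (auto simp: survivors_def)
    define z where "z = itin x"
    have v: "val (sdrop n z) = (doubling ^^ n) x" for n
      unfolding z_def sdrop_itin by (rule val_itin[OF doubling_pow_mem[OF x1]])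
    have nh: "val (sdrop n z) \<le> a \<or> val (sdrop n z) \<ge> b" for n
      using x v by (auto simp: survivors_def not_less)
    have "evper z"
    proof (rule AB)
      fix n assume "\<not> z !! n"
      then have "val (sdrop n z) \<le> 1/2" using v by (simp add: z_def itin_def)
      then have "val (sdrop n z) \<le> val A" using nh[of n] assms B2 by linarith
      then show "sle (sdrop n z) A"
        using slt_val_less[of A "sdrop n z"] A not_sle_iff by force
    next
      fix n assume "z !! n"
      then have "val (sdrop n z) > 1/2" using v by (simp add: z_def itin_def)
      then have "val B < val (sdrop n z)" using nh[of n] assms by linarith
      then show "slt B (sdrop n z)" by (rule val_less_slt)
    qed
    moreover have "x = val z" using x1 by (simp add: z_def val_itin)
    ultimately show "x \<in> val ` {z. evper z}" by blast
  qed
qed (use countable_evper in auto)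

text \<open>\<open>itin\<close> embeds the unit interval, with left inverse
  \<open>val\<close>.\<close>

lemma uncountable_bool_stream: "uncountable (UNIV :: bool stream set)"
proof
  assume "countable (UNIV :: bool stream set)"
  then have "countable (itin ` {0..1})" by (rule countable_subset[rotated]) simp
  moreover have "inj_on itin {0..1}" by (metis inj_onI val_itin)
  ultimately have "countable {0..1::real}" by (rule countable_image_inj_on)
  then show False using uncountable_closed_interval[of 0 "1::real"] by simp
qed

section \<open>Cyclically balanced words\<close>

text \<open>The prefix of length \<open>i\<close> has \<open>\<lfloor>(\<theta> + i p) / q\<rfloor>\<close> ones.\<close>

definition cword :: "nat \<Rightarrow> nat \<Rightarrow> nat \<Rightarrow> bool list" where
  "cword p q \<theta> = map (\<lambda>i. (\<theta> + i * p) div q < (\<theta> + Suc i * p) div q) [0..<q]"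

lemma length_cword [simp]: "length (cword p q \<theta>) = q"
  by (simp add: cword_def)

lemma div_add_le_Suc:
  fixes a p q :: nat assumes "p \<le> q" "0 < q"
  shows "(a + p) div q = a div q + of_bool (a div q < (a + p) div q)"
proof -
  have "(a + p) div q \<le> (a + q) div q" using assms by (intro div_le_mono) simp
  moreover have "(a + q) div q = a div q + 1" using assms by simp
  moreover have "a div q \<le> (a + p) div q" by (intro div_le_mono) simp
  ultimately show ?thesis by auto
qed

lemma ones_take_cword:
  assumes "p \<le> q" "\<theta> < q" "i \<le> q"
  shows "ones (take i (cword p q \<theta>)) = (\<theta> + i * p) div q"
  using assms(3)
proof (induction i)
  case 0
  then show ?case using assms by simp
next
  case (Suc i)
  have "ones (take (Suc i) (cword p q \<theta>)) = (\<theta> + i * p) div q +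
      of_bool ((\<theta> + i * p) div q < (\<theta> + i * p + p) div q)"
    using Suc by (simp add: take_Suc_conv_app_nth cword_def add_ac)
  also have "\<dots> = (\<theta> + i * p + p) div q"
    using assms by (intro div_add_le_Suc[symmetric]) auto
  finally show ?case by (simp add: add_ac)
qed

lemma ones_cword: "p \<le> q \<Longrightarrow> \<theta> < q \<Longrightarrow> ones (cword p q \<theta>) = p"
  using ones_take_cword[of p q \<theta> q] by simp

lemma ones_take_cword2:
  assumes "p \<le> q" "\<theta> < q" "i \<le> 2 * q"
  shows "ones (take i (cword p q \<theta> @ cword p q \<theta>)) = (\<theta> + i * p) div q"
proof (cases "i \<le> q")
  case True
  then show ?thesis using assms by (simp add: ones_take_cword)
next
  case False
  then have "ones (take i (cword p q \<theta> @ cword p q \<theta>)) = p + (\<theta> + (i - q) * p) div q"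
    using assms by (simp add: ones_take_cword ones_cword)
  also have "\<dots> = (\<theta> + (i - q) * p + p * q) div q" using assms by simp
  also have "\<theta> + (i - q) * p + p * q = \<theta> + i * p"
  proof -
    obtain d where "i = q + d" using False by (metis le_Suc_ex nat_le_linear)
    then show ?thesis by (simp add: algebra_simps)
  qed
  finally show ?thesis .
qed

lemma div_add_bounds:
  fixes a b q :: nat
  shows "a div q + b div q \<le> (a + b) div q" "(a + b) div q \<le> a div q + b div q + 1"
proof -
  have "(a mod q + b mod q) div q \<le> 1" if "q > 0"
  proof -
    have "a mod q + b mod q < 2 * q" using mod_less_divisor[OF that] by (simp add: add_strict_mono mult_2)
    then have "(a mod q + b mod q) div q < 2" using less_mult_imp_div_less by blast
    then show ?thesis by simp
  qed
  then show "a div q + b div q \<le> (a + b) div q" "(a + b) div q \<le> a div q + b div q + 1"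
    by (cases "q = 0"; simp add: div_add1_eq[of a b q])+
qed

text \<open>The number of ones in a factor of length \<open>l\<close> is a difference of two integer
  parts taken \<open>l p / q\<close> apart, hence one of two consecutive values that depend only on
  \<open>l\<close>.\<close>

lemma cyclically_balanced_cword:
  assumes "p \<le> q" "\<theta> < q" shows "cyclically_balanced (cword p q \<theta>)"
proof -
  define W where "W = cword p q \<theta> @ cword p q \<theta>"
  have *: "l * p div q \<le> ones u \<and> ones u \<le> l * p div q + 1" if u: "sublist u W" "length u = l" for u l
  proof -
    obtain ps ss where W: "W = ps @ u @ ss" using u(1) unfolding sublist_def by blast
    have "length W = 2 * q" by (simp add: W_def)
    then have len: "length ps + l \<le> 2 * q" using W u by simp
    have "ones ps = (\<theta> + length ps * p) div q"
      using ones_take_cword2[OF assms, of "length ps"] len W by (simp add: W_def[symmetric])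
    moreover have "ones ps + ones u = (\<theta> + length ps * p + l * p) div q"
      using ones_take_cword2[OF assms, of "length ps + l"] len W u(2)
      by (simp add: W_def[symmetric] algebra_simps)
    ultimately show ?thesis
      using div_add_bounds[where a = "\<theta> + length ps * p" and b = "l * p" and q = q] by auto
  qed
  have "\<bar>int (ones u) - int (ones v)\<bar> \<le> 1" if "sublist u W" "sublist v W" "length u = length v" for u v
    using *[OF that(1) refl] *[OF that(2) refl] that(3) by auto
  then show ?thesis unfolding cyclically_balanced_def balanced_def W_def by blast
qed

lemma eq_by_ones:
  assumes "length v = length w" "\<And>i. i \<le> length v \<Longrightarrow> ones (take i v) = ones (take i w)"
  shows "v = w"
proof (rule nth_equalityI)
  fix i assume i: "i < length v"
  then show "v ! i = w ! i"
    using assms(2)[of i] assms(2)[of "Suc i"] assms(1)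
    by (auto simp: take_Suc_conv_app_nth split: if_splits)
qed fact

text \<open>The factors of length \<open>l\<close> of \<open>w\<^sup>\<infinity>\<close> have \<open>l p / q\<close> ones on average and their numbers of ones
  differ by at most 1. Hence the discrepancy \<open>D i\<close> varies by less than \<open>q\<close>.\<close>

lemma cyclically_balanced_is_cword:
  assumes bal: "cyclically_balanced w" and q: "length w = q" "0 < q" and p: "ones w = p"
  shows "\<exists>\<theta><q. w = cword p q \<theta>"
proof -
  define N where "N i = int (ones (take i (w @ w)))" for i
  define c where "c l i = N (i + l) - N i" for l i
  have per: "N (i + q) = int p + N i" if "i \<le> q" for i
    using that q p by (simp add: N_def)
  have c_ones: "c l i = int (ones (take l (drop i (w @ w))))" for l i
    using arg_cong[OF take_add[of i l "w @ w"], of ones] by (simp add: c_def N_def)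
  have c_bal: "\<bar>c l i - c l j\<bar> \<le> 1" if "i \<le> q" "j \<le> q" "l \<le> q" for l i j
  proof -
    have "sublist (take l (drop k (w @ w))) (w @ w)" for k
      by (meson sublist_drop sublist_order.order_trans sublist_take)
    moreover have "length (take l (drop k (w @ w))) = l" if "k \<le> q" for k
      using that q \<open>l \<le> q\<close> by simp
    ultimately show ?thesis
      using bal that unfolding cyclically_balanced_def balanced_def c_ones by presburger
  qed
  have tel: "(\<Sum>i<k. N (Suc (i + l)) - N (i + l)) = N (k + l) - N l" for k l
    by (induction k) auto
  \<comment> \<open>Over all starting points, each letter of the cyclic word is counted
    \<open>l\<close> times.\<close>
  have c_sum: "(\<Sum>i<q. c l i) = int (l * p)" if "l \<le> q" for l
    using that
  proof (induction l)
    case 0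
    then show ?case by (simp add: c_def)
  next
    case (Suc l)
    have "(\<Sum>i<q. c (Suc l) i) = (\<Sum>i<q. c l i) + (\<Sum>i<q. N (Suc (i + l)) - N (i + l))"
      by (simp add: c_def sum.distrib[symmetric])
    also have "(\<Sum>i<q. N (Suc (i + l)) - N (i + l)) = int p"
      using per[of l] Suc.prems by (simp add: tel add.commute)
    finally show ?case using Suc by simp
  qed
  define D where "D i = int q * N i - int (i * p)" for i
  have D_step: "\<bar>D (i + l) - D i\<bar> \<le> int q - 1" if "i < q" "l \<le> q" for i l
  proof -
    have "D (i + l) - D i = int q * c l i - (\<Sum>j<q. c l j)"
      using c_sum[OF that(2)] by (simp add: D_def c_def algebra_simps)
    also have "\<dots> = (\<Sum>j<q. c l i - c l j)" by (simp add: sum_subtractf)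
    \<comment> \<open>The summand \<open>j = i\<close> vanishes, which improves the bound from
      \<open>q\<close> to \<open>q - 1\<close>.\<close>
    also have "\<dots> = (\<Sum>j\<in>{..<q} - {i}. c l i - c l j)"
      using that by (subst sum.remove[of _ i]) auto
    finally have "\<bar>D (i + l) - D i\<bar> \<le> (\<Sum>j\<in>{..<q} - {i}. \<bar>c l i - c l j\<bar>)"
      using sum_abs by metis
    also have "\<dots> \<le> (\<Sum>j\<in>{..<q} - {i}. 1)"
      using that by (intro sum_mono c_bal) auto
    also have "\<dots> = int q - 1" using that by (simp add: of_nat_diff)
    finally show ?thesis .
  qed
  have D_bound: "D j - D i \<le> int q - 1" if "i \<le> q" "j \<le> q" for i j
  proof (cases i j rule: linorder_cases)
    case less
    then have "i < q" "j - i \<le> q" using that by auto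
    then show ?thesis using D_step[of i "j - i"] less by simp
  next
    case equal
    then show ?thesis using q by simp
  next
    case greater
    then have "j < q" "i - j \<le> q" using that by auto
    then show ?thesis using D_step[of j "i - j"] greater by simp
  qed
  define m where "m = Min (D ` {..q})"
  have "m \<in> D ` {..q}" unfolding m_def by (intro Min_in) auto
  then obtain k where k: "k \<le> q" "m = D k" by auto
  have m_le: "m \<le> D i" if "i \<le> q" for i
    unfolding m_def using that by (intro Min_le) auto
  have "D 0 = 0" by (simp add: D_def N_def)
  then have m: "m \<le> 0" "0 \<le> m + int q - 1" using m_le[of 0] D_bound[of k 0] k by auto
  \<comment> \<open>This choice puts every \<open>D i\<close> between
    \<open>\<theta> - q + 1\<close> and \<open>\<theta>\<close>, which says that \<open>N i\<close>
    is the integer part of \<open>(\<theta> + i p) / q\<close>.\<close>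
  define \<theta> where "\<theta> = nat (m + int q - 1)"
  have \<theta>: "int \<theta> = m + int q - 1" "\<theta> < q" using m by (auto simp: \<theta>_def)
  have p_le: "p \<le> q" using p q count_le_length[of w True] by simp
  have "ones (take i w) = (\<theta> + i * p) div q" if "i \<le> q" for i
  proof -
    have "int q * N i \<le> int \<theta> + int (i * p)" "int \<theta> + int (i * p) < int q * (N i + 1)"
      using m_le[OF that] D_bound[OF k(1) that] k(2) \<theta>(1) by (auto simp: D_def algebra_simps)
    moreover have "N i = int (ones (take i w))" using that q by (simp add: N_def)
    ultimately have "int (q * ones (take i w)) \<le> int (\<theta> + i * p)"
      "int (\<theta> + i * p) < int (q * Suc (ones (take i w)))" by (simp_all add: algebra_simps)
    then show ?thesis unfolding of_nat_le_iff of_nat_less_iff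
      by (intro div_nat_eqI[symmetric]) (auto simp: mult.commute)
  qed
  then have "w = cword p q \<theta>"
    using q p_le \<theta>(2) by (intro eq_by_ones) (auto simp: ones_take_cword)
  then show ?thesis using \<theta>(2) by blast
qed

section \<open>The extremal cyclically balanced words\<close>

lemma list_le_by_ones:
  assumes "length v = length w" "\<And>i. i \<le> length v \<Longrightarrow> ones (take i v) \<le> ones (take i w)"
  shows "v \<le> w"
  using assms
proof (induction v arbitrary: w)
  case (Cons c v)
  then obtain d u where w: "w = d # u" by (cases w) auto
  have cd: "c \<le> d" using Cons.prems(2)[of 1] by (auto simp: w split: if_splits)
  show ?case
  proof (cases "c = d")
    case True
    have "v \<le> u"
    proof (rule Cons.IH)
      fix i assume "i \<le> length v"
      then show "ones (take i v) \<le> ones (take i u)"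
        using Cons.prems(2)[of "Suc i"] True by (auto simp: w split: if_splits)
    qed (use Cons.prems w in simp)
    then show ?thesis using True w by simp
  next
    case False
    then show ?thesis using cd w by simp
  qed
qed simp

lemma rat_num_den:
  assumes "r \<in> unit_rats"
  shows "0 < rat_num r" "rat_num r < rat_den r" "coprime (rat_num r) (rat_den r)"
    "real_of_rat r = real (rat_num r) / real (rat_den r)"
proof -
  obtain a b where ab: "quotient_of r = (a, b)" by fastforce
  have b: "b > 0" "coprime a b" and r: "r = rat_of_int a / rat_of_int b"
    using ab quotient_of_denom_pos quotient_of_coprime quotient_of_div by blast+
  have "0 < rat_of_int a" "rat_of_int a < rat_of_int b"
    using assms b r by (auto simp: zero_less_divide_iff divide_less_eq)
  then have a: "0 < a" "a < b" by auto
  have *: "rat_num r = nat a" "rat_den r = nat b" by (auto simp: rat_num_def rat_den_def ab)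
  show "0 < rat_num r" "rat_num r < rat_den r" using a by (auto simp: *)
  show "coprime (rat_num r) (rat_den r)" using a b coprime_int_iff[of "nat a" "nat b"] by (simp add: *)
  have "real_of_rat r = real_of_int a / real_of_int b" by (simp add: r of_rat_divide)
  then show "real_of_rat r = real (rat_num r) / real (rat_den r)" using a by (simp add: *)
qed

lemma cyc_words_eq:
  assumes "r \<in> unit_rats"
  shows "cyc_words r = cword (rat_num r) (rat_den r) ` {..<rat_den r}"
proof -
  note r = rat_num_den[OF assms]
  have "0 < rat_den r" using r by simp
  then show ?thesis
    using cyclically_balanced_is_cword[of _ "rat_den r" "rat_num r"]
      cyclically_balanced_cword[of "rat_num r" "rat_den r"] ones_cword[of "rat_num r" "rat_den r"] r
    unfolding cyc_words_def by auto
qed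

lemma hd_cword:
  assumes "p \<le> q" "\<theta> < q" shows "hd (cword p q \<theta>) \<longleftrightarrow> q \<le> \<theta> + p"
proof -
  have "hd (cword p q \<theta>) = cword p q \<theta> ! 0" using assms by (intro hd_conv_nth) (simp flip: length_0_conv)
  also have "\<dots> \<longleftrightarrow> \<theta> div q < (\<theta> + p) div q" using assms by (simp add: cword_def)
  also have "\<dots> \<longleftrightarrow> q \<le> \<theta> + p" using assms by (simp add: div_greater_zero_iff)
  finally show ?thesis .
qed

lemma cword_mono: "p \<le> q \<Longrightarrow> \<theta> \<le> \<theta>' \<Longrightarrow> \<theta>' < q \<Longrightarrow> cword p q \<theta> \<le> cword p q \<theta>'"
  by (intro list_le_by_ones) (auto simp: ones_take_cword intro!: div_le_mono)

text \<open>By \<open>hd_cword\<close> a word begins with 0 exactly for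
  \<open>\<theta> < q - p\<close>, and by \<open>cword_mono\<close> the largest such \<theta> gives
  the largest word. The argument for \<open>omega_plus\<close> is dual.\<close>

lemma omega_minus_eq:
  assumes "r \<in> unit_rats"
  shows "omega_minus r = cword (rat_num r) (rat_den r) (rat_den r - rat_num r - 1)"
  unfolding omega_minus_def cyc_words_eq[OF assms]
  using rat_num_den[OF assms]
  by (intro Max_eqI) (auto simp: hd_cword intro!: cword_mono)

lemma omega_plus_eq:
  assumes "r \<in> unit_rats"
  shows "omega_plus r = cword (rat_num r) (rat_den r) (rat_den r - rat_num r)"
  unfolding omega_plus_def cyc_words_eq[OF assms]
  using rat_num_den[OF assms]
  by (intro Min_eqI) (auto simp: hd_cword intro!: cword_mono)

section \<open>The substitution of a single rational\<close>

text \<open>Along a chain of points of \<open>A\<close> the integer \<open>f\<close> drops by at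
  least 1 at each link, and within a link it rises by at most \<open>c\<close>; so it falls below
  every bound and stays there.\<close>

lemma drift:
  fixes f :: "nat \<Rightarrow> int"
  assumes step: "\<And>n. n \<in> A \<Longrightarrow> \<exists>m>n. m \<in> A \<and> f m < f n \<and> (\<forall>i. n \<le> i \<and> i \<le> m \<longrightarrow> f i \<le> f n + c)"
    and "n \<in> A"
  shows "\<exists>M. \<forall>i\<ge>M. f i < K"
proof -
  \<comment> \<open>Links are followed from \<open>n\<close> until one reaches \<open>i\<close>;
    each of them starts lower than the one before.\<close>
  have *: "f i \<le> f n + c" if "n \<in> A" "n \<le> i" for n i
    using that
  proof (induction "i - n" arbitrary: n rule: less_induct)
    case less
    obtain m where m: "m > n" "m \<in> A" "f m < f n" "\<forall>i. n \<le> i \<and> i \<le> m \<longrightarrow> f i \<le> f n + c"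
      using step[OF less.prems(1)] by blast
    show ?case
    proof (cases "i \<le> m")
      case False
      then have "f i \<le> f m + c" using less.hyps[of m] m less.prems by auto
      then show ?thesis using m by simp
    qed (use m less.prems in auto)
  qed
  have "\<exists>m\<in>A. f m \<le> f n - int k" for k
  proof (induction k)
    case 0
    then show ?case using assms(2) by auto
  next
    case (Suc k)
    then obtain m where "m \<in> A" "f m \<le> f n - int k" by blast
    then obtain m' where "m' \<in> A" "f m' < f m" using step[of m] by blast
    then show ?case using \<open>f m \<le> f n - int k\<close> by (intro bexI[of _ m']) auto
  qed
  from this[of "nat (f n + c + 1 - K)"] obtain m where m: "m \<in> A" "f m \<le> f n - int (nat (f n + c + 1 - K))"
    by blast
  then have "f i < K" if "i \<ge> m" for i using *[OF m(1) that] by linarith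
  then show ?thesis by blast
qed

text \<open>The rational is given by numerator and denominator so that prefix counts become integer
  divisions; \<open>slope_rat\<close> links this to \<open>rat\<close>.\<close>

locale slope =
  fixes p q :: nat
  assumes p_pos: "0 < p" and p_less: "p < q" and coprime: "coprime p q"
begin

definition "sR = cword p q (q - p - 1)"
definition "tR = cword p q (q - p)"

abbreviation "sub \<equiv> sbl sR tR"

lemma length_sR [simp]: "length sR = q" and length_tR [simp]: "length tR = q"
  by (simp_all add: sR_def tR_def)

lemma q_pos: "0 < q" using p_less by simp

lemma blk: "blk sR tR"
  unfolding blk_def using p_pos p_less hd_cword[of p q "q - p - 1"] hd_cword[of p q "q - p"]
  by (auto simp: sR_def tR_def simp flip: length_0_conv)

lemma cnt_sub_block: "i \<le> q \<Longrightarrow>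
    cnt (sub x) (k * q + i) = int (k * p) + int (ones (take i (if x !! k then tR else sR)))"
proof (induction k arbitrary: x)
  case 0
  then show ?case by (cases x) (auto simp: sbl_Stream[OF blk] cnt_shift_take)
next
  case (Suc k)
  obtain c y where x: "x = c ## y" by (cases x)
  define b where "b = (if c then tR else sR)"
  have b: "length b = q" "ones b = p"
    using p_pos p_less by (auto simp: b_def sR_def tR_def ones_cword)
  have "cnt (sub x) (Suc k * q + i) = cnt (b @- sub y) (length b + (k * q + i))"
    by (simp add: x sbl_Stream[OF blk] b add_ac b_def[symmetric])
  then show ?case unfolding cnt_shift using Suc b x by simp
qed

text \<open>Both blocks contain \<open>p\<close> ones and their parameters \<theta> differ by 1, so
  one formula holds in all blocks: the source word enters only through the letter of the current
  block. The prefix counted ends with position \<open>j\<close>.\<close>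

lemma cnt_sub:
  "cnt (sub x) (Suc j) = int ((j * p + q - 1 + of_bool (x !! (j div q))) div q)"
proof -
  define k i where "k = j div q" and "i = j mod q"
  have i: "i < q" "j = k * q + i" using q_pos by (auto simp: k_def i_def)
  define \<theta> where "\<theta> = q - p - 1 + of_bool (x !! k)"
  have w: "(if x !! k then tR else sR) = cword p q \<theta>"
    using p_less by (auto simp: \<theta>_def sR_def tR_def Suc_diff_Suc)
  have "cnt (sub x) (Suc j) = int (k * p + (\<theta> + Suc i * p) div q)"
    using cnt_sub_block[of "Suc i" x k] i p_less w p_pos
    by (simp add: ones_take_cword \<theta>_def)
  also have "k * p + (\<theta> + Suc i * p) div q = (\<theta> + Suc i * p + k * p * q) div q"
    using q_pos by simp
  also have "\<theta> + Suc i * p + k * p * q = j * p + q - 1 + of_bool (x !! k)"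
    using p_less unfolding \<theta>_def i(2) by (simp add: algebra_simps)
  finally show ?thesis by (simp add: k_def)
qed

lemma cnt_sub_zeros: "cnt (sub (constw False)) (Suc j) = int ((j * p + q - 1) div q)"
  and cnt_sub_ones: "cnt (sub (constw True)) (Suc j) = int ((j * p + q) div q)"
  using q_pos by (simp_all add: cnt_sub)

lemma cnt_sub_bounds:
  "int ((j * p + q - 1) div q) \<le> cnt (sub x) (Suc j)"
  "cnt (sub x) (Suc j) \<le> int ((j * p + q) div q)"
  unfolding cnt_sub of_nat_le_iff using q_pos by (intro div_le_mono, simp)+

text \<open>By coprimality \<open>j p / q\<close> is not an integer. Thus the two bounds of
  \<open>cnt_sub_bounds\<close> coincide: all images have the same count up to and including
  position \<open>j\<close> unless \<open>j\<close> starts a block.\<close>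

lemma unaligned_div:
  assumes "\<not> q dvd j" shows "(j * p + q - 1) div q = (j * p + q) div q"
proof -
  have "\<not> q dvd j * p + q"
    using assms coprime by (simp add: coprime_commute coprime_dvd_mult_left_iff)
  then have "(j * p + q) mod q \<noteq> 0" by (simp add: dvd_eq_mod_eq_0)
  define A where "A = j * p + q"
  have "A mod q < q" "A mod q \<noteq> 0" using q_pos \<open>(j * p + q) mod q \<noteq> 0\<close> by (auto simp: A_def)
  moreover have "A = q * (A div q) + A mod q" by simp
  ultimately have "q * (A div q) \<le> A - 1" "A - 1 < q * Suc (A div q)"
    unfolding mult_Suc_right by linarith+
  then have "(A - 1) div q = A div q" by (intro div_nat_eqI) auto
  then show ?thesis by (simp add: A_def)
qed

text \<open>The 0 at \<open>n\<close> makes the counts before and after it equal, and the latter is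
  independent of \<open>x\<close> by \<open>unaligned_div\<close>. Hence among the tails starting
  with 0 only those at block boundaries can exceed \<open>s^inf\<close>.\<close>

lemma unaligned_zero:
  assumes "\<not> q dvd n" "\<not> sub x !! n"
  shows "sle (sdrop n (sub x)) (sub (constw False))"
proof (rule sle_by_cnt)
  fix i
  show "cnt (sdrop n (sub x)) i \<le> cnt (sub (constw False)) i"
  proof (cases i)
    case (Suc j)
    have "cnt (sub x) n = cnt (sub x) (Suc n)" using assms by (simp add: cnt_Suc)
    then have "cnt (sdrop n (sub x)) i = cnt (sub x) (Suc (n + j)) - cnt (sub x) (Suc n)"
      using cnt_sdrop[of "sub x" n i] Suc by simp
    also have "\<dots> \<le> int (((n + j) * p + q) div q) - int ((n * p + q) div q)"
      using cnt_sub_bounds(2)[where j="n + j" and x=x] cnt_sub_bounds(1)[where j=n and x=x] unaligned_div[OF assms(1)]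
      by linarith
    also have "\<dots> \<le> int ((j * p + q - 1) div q)"
    proof -
      \<comment> \<open>The integer part of a sum is at most the integer part of one term plus the
        other term rounded up.\<close>
      have "(n * p + q + j * p) div q \<le> (n * p + q) div q + (j * p + q - 1) div q"
      proof -
        define A B where "A = n * p + q" and "B = j * p"
        have "A = A div q * q + A mod q" by simp
        then have "A + B \<le> B + q - 1 + A div q * q"
          using mod_less_divisor[OF q_pos, of A] by linarith
        then have "(A + B) div q \<le> (B + q - 1 + A div q * q) div q" by (rule div_le_mono)
        also have "(C + A div q * q) div q = A div q + C div q" for C using q_pos by simp
        finally show ?thesis by (simp add: A_def B_def)
      qed
      moreover have "(n + j) * p + q = n * p + q + j * p" by (simp add: add_mult_distrib)
      ultimately have "((n + j) * p + q) div q \<le> (n * p + q) div q + (j * p + q - 1) div q"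
        by (simp only:)
      then show ?thesis by linarith
    qed
    finally show ?thesis using Suc by (simp add: cnt_sub_zeros)
  qed simp
qed

text \<open>Mirror image of \<open>unaligned_zero\<close>: the 1 at \<open>n\<close> supplies the
  extra 1 in the count of \<open>t^inf\<close>, and integer parts are superadditive.\<close>

lemma unaligned_one:
  assumes "\<not> q dvd n" "sub x !! n"
  shows "sle (sub (constw True)) (sdrop n (sub x))"
proof (rule sle_by_cnt)
  fix i
  show "cnt (sub (constw True)) i \<le> cnt (sdrop n (sub x)) i"
  proof (cases i)
    case (Suc j)
    have "(n * p + q - 1) div q + (j * p) div q \<le> (n * p + q - 1 + j * p) div q"
      by (rule div_add_bounds)
    also have "n * p + q - 1 + j * p = (n + j) * p + q - 1"
      using q_pos unfolding add_mult_distrib by linarith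
    finally have *: "(n * p + q) div q + (j * p) div q \<le> ((n + j) * p + q - 1) div q"
      using unaligned_div[OF assms(1)] by simp
    have "int ((j * p + q) div q) = 1 + int ((j * p) div q)" using q_pos by simp
    also have "\<dots> \<le> 1 + int (((n + j) * p + q - 1) div q) - int ((n * p + q) div q)"
      using * by linarith
    also have "\<dots> \<le> 1 + cnt (sub x) (Suc (n + j)) - cnt (sub x) (Suc n)"
      using cnt_sub_bounds(1)[where j="n + j" and x=x] cnt_sub_bounds(2)[where j=n and x=x] by linarith
    also have "cnt (sub x) (Suc n) = cnt (sub x) n + 1" using assms by (simp add: cnt_Suc)
    also have "1 + cnt (sub x) (Suc (n + j)) - (cnt (sub x) n + 1) = cnt (sdrop n (sub x)) i"
      using cnt_sdrop[of "sub x" n i] Suc by simp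
    finally show ?thesis using Suc by (simp add: cnt_sub_ones)
  qed simp
qed

text \<open>If no tail of \<open>z\<close> lies between \<open>s\<^sup>\<infinity>\<close> and \<open>t\<^sup>\<infinity>\<close>, then the discrepancy
  \<open>q |z\<^sub>1\<dots>z\<^sub>n|\<^sub>1 - n p\<close> tends to \<open>-\<infinity>\<close> as soon as a 0 occurs, and to \<open>\<infinity>\<close> as soon as a 1 occurs.\<close>

lemma outside_imp_constw:
  assumes zero: "\<And>n. \<not> z !! n \<Longrightarrow> slt (sdrop n z) (sub (constw False))"
    and one: "\<And>n. z !! n \<Longrightarrow> slt (sub (constw True)) (sdrop n z)"
  shows "z = constw False \<or> z = constw True"
proof -
  define f where "f n = int q * cnt z n - int (n * p)" for n
  have f_add: "f (n + j) = f n + (int q * cnt (sdrop n z) j - int (j * p))" for n j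
    using cnt_sdrop[of z n j] by (simp add: f_def algebra_simps)
  \<comment> \<open>The first difference from \<open>s^inf\<close> is again a 0 of \<open>z\<close>,
    so the comparison restarts there. Up to it \<open>z\<close> agrees with \<open>s^inf\<close>,
    whose count has fallen below the slope because its next letter is a 1.\<close>
  have step0: "\<exists>m>n. m \<in> {n. \<not> z !! n} \<and> f m < f n \<and> (\<forall>i. n \<le> i \<and> i \<le> m \<longrightarrow> f i \<le> f n + int q)"
    if n: "n \<in> {n. \<not> z !! n}" for n
  proof -
    define S where "S = sub (constw False)"
    obtain d where d: "\<forall>i<d. sdrop n z !! i = S !! i" "\<not> sdrop n z !! d" "S !! d"
    proof -
      have "slt (sdrop n z) S" using zero n by (simp add: S_def)
      then show ?thesis using that unfolding slt_def by blast
    qed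
    have "S !! 0 = False" using snth_sbl_mult[OF blk, of "constw False" 0] by (simp add: S_def)
    then have "d > 0" using d(3) by (cases "d = 0") simp_all
    have eq: "cnt (sdrop n z) j = cnt S j" if "j \<le> d" for j
      using d(1) that by (intro cnt_cong) auto
    have S: "int q * cnt S (Suc j) \<le> int (j * p + q - 1)" for j
      unfolding S_def cnt_sub_zeros of_nat_mult[symmetric] of_nat_le_iff by simp
    have "int q * cnt S d \<le> int (d * p) - 1"
    proof -
      have "cnt S (Suc d) = cnt S d + 1" using d(3) by (simp add: cnt_Suc)
      then have "int q * cnt S d + int q \<le> int (d * p + q - 1)"
        using S[of d] by (simp only: distrib_left mult_1_right)
      then show ?thesis using q_pos by linarith
    qed
    then have "f (n + d) < f n" unfolding f_add eq[OF order_refl] by simp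
    moreover have "f i \<le> f n + int q" if "n \<le> i" "i \<le> n + d" for i
    proof -
      define j where "j = i - n"
      have j: "i = n + j" "j \<le> d" using that by (auto simp: j_def)
      have "int q * cnt S j \<le> int (j * p) + int q"
      proof (cases j)
        case (Suc j')
        have "int (j' * p + q - 1) \<le> int (j * p) + int q"
          unfolding of_nat_add[symmetric] of_nat_le_iff using Suc by simp
        then have "int q * cnt S (Suc j') \<le> int (j * p) + int q" using S[of j'] by linarith
        then show ?thesis by (simp only: Suc)
      qed simp
      then show ?thesis unfolding j(1) f_add eq[OF j(2)] by simp
    qed
    moreover have "n + d > n" "z !! (n + d) = sdrop n z !! d" using \<open>d > 0\<close> by (simp_all add: sdrop_snth)
    ultimately show ?thesis using d(2) unfolding mem_Collect_eq by blast
  qed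
  \<comment> \<open>Dually, the first difference from \<open>t^inf\<close> is a 1 of
    \<open>z\<close> where \<open>t^inf\<close> has a 0, and the count lies above the slope.\<close>
  have step1: "\<exists>m>n. m \<in> {n. z !! n} \<and> - f m < - f n \<and> (\<forall>i. n \<le> i \<and> i \<le> m \<longrightarrow> - f i \<le> - f n + int q)"
    if n: "n \<in> {n. z !! n}" for n
  proof -
    define S where "S = sub (constw True)"
    obtain d where d: "\<forall>i<d. sdrop n z !! i = S !! i" "sdrop n z !! d" "\<not> S !! d"
    proof -
      have "slt S (sdrop n z)" using one n by (simp add: S_def)
      then obtain d where "\<forall>i<d. S !! i = sdrop n z !! i" "\<not> S !! d" "sdrop n z !! d"
        unfolding slt_def by blast
      then show ?thesis using that[of d] by simp
    qed
    have "S !! 0 = True" using snth_sbl_mult[OF blk, of "constw True" 0] by (simp add: S_def)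
    then have "d > 0" using d(3) by (cases "d = 0") simp_all
    have eq: "cnt (sdrop n z) j = cnt S j" if "j \<le> d" for j
      using d(1) that by (intro cnt_cong) auto
    have S: "int (j * p) + 1 \<le> int q * cnt S (Suc j)" for j
    proof -
      have "j * p + q < q + q * ((j * p + q) div q)" using dividend_less_times_div[OF q_pos] .
      then have "int (j * p + 1) \<le> int (q * ((j * p + q) div q))" by linarith
      then show ?thesis unfolding S_def cnt_sub_ones by simp
    qed
    have "int (d * p) + 1 \<le> int q * cnt S d"
      using S[of d] d(3) by (simp add: cnt_Suc)
    then have "- f (n + d) < - f n" unfolding f_add eq[OF order_refl] by simp
    moreover have "- f i \<le> - f n + int q" if "n \<le> i" "i \<le> n + d" for i
    proof -
      define j where "j = i - n"
      have j: "i = n + j" "j \<le> d" using that by (auto simp: j_def)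
      have "int (j * p) \<le> int q * cnt S j + int q"
      proof (cases j)
        case (Suc j')
        have "int (j * p) \<le> int (j' * p) + int q" using Suc p_less by simp
        then have "int (j * p) \<le> int q * cnt S (Suc j') + int q" using S[of j'] by linarith
        then show ?thesis by (simp only: Suc)
      qed simp
      then show ?thesis unfolding j(1) f_add eq[OF j(2)] by simp
    qed
    moreover have "n + d > n" "z !! (n + d) = sdrop n z !! d" using \<open>d > 0\<close> by (simp_all add: sdrop_snth)
    ultimately show ?thesis using d(2) unfolding mem_Collect_eq by blast
  qed
  show ?thesis
  proof (rule ccontr)
    \<comment> \<open>With both letters present, \<open>f\<close> would be eventually positive and
      eventually negative.\<close>
    assume neg: "\<not> ?thesis"
    have "\<exists>k. z !! k"
    proof (rule ccontr)
      assume "\<nexists>k. z !! k"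
      then have "z = constw False" by (intro stream_eqI) simp
      then show False using neg by blast
    qed
    then obtain k where "k \<in> {n. z !! n}" by blast
    then obtain M where M: "\<forall>i\<ge>M. - f i < 0"
      using drift[where f = "\<lambda>n. - f n" and K = 0, OF step1] by blast
    have "\<exists>l. \<not> z !! l"
    proof (rule ccontr)
      assume "\<nexists>l. \<not> z !! l"
      then have "z = constw True" by (intro stream_eqI) simp
      then show False using neg by blast
    qed
    then obtain l where "l \<in> {n. \<not> z !! n}" by blast
    then obtain M' where M': "\<forall>i\<ge>M'. f i < 0"
      using drift[where f = f and K = 0, OF step0] by blast
    have "- f (max M M') < 0" "f (max M M') < 0" using M M' by (metis max.cobounded1, metis max.cobounded2)
    then show False by simp
  qed
qed

text \<open>A tail between \<open>s^inf\<close> and \<open>t^inf\<close> that starts with 0 lies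
  between \<open>s s^inf\<close> and \<open>s t^inf\<close>, so it starts with \<open>s\<close> and
  the rest is again between \<open>s^inf\<close> and \<open>t^inf\<close>; likewise for 1 and
  \<open>t\<close>. The source word consists of the first letters of the blocks.\<close>

lemma between_imp_sub:
  assumes zero: "\<And>n. \<not> z !! n \<Longrightarrow> sle (sdrop n z) (sub (False ## constw True))"
    and one: "\<And>n. z !! n \<Longrightarrow> sle (sub (True ## constw False)) (sdrop n z)"
    and z: "sle (sub (constw False)) z" "sle z (sub (constw True))"
  shows "\<exists>x. z = sub x"
proof -
  define x where "x = smap (\<lambda>k. z !! (k * q)) nats"
  have unroll: "sR @- sub (constw False) = sub (constw False)" "tR @- sub (constw True) = sub (constw True)"
    using sbl_Stream[OF blk, of True "constw True"] sbl_Stream[OF blk, of False "constw False"]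
    by (simp_all only: constw_unfold[symmetric] if_True if_False)
  have step: "\<exists>y'. y = (if y !! 0 then tR else sR) @- y' \<and> sle (sub (constw False)) y' \<and> sle y' (sub (constw True))"
    if y: "y = sdrop n z" "sle (sub (constw False)) y" "sle y (sub (constw True))" for y n
  proof (cases "y !! 0")
    case True
    have "z !! n" using True y(1) by (simp add: sdrop_snth)
    from one[OF this] have 1: "sle (tR @- sub (constw False)) y"
      unfolding y(1) by (simp only: sbl_Stream[OF blk] if_True)
    have 2: "sle y (tR @- sub (constw True))" using y(3) unroll(2) by simp
    obtain y' where "y = tR @- y'" "sle (sub (constw False)) y'" "sle y' (sub (constw True))"
      using sle_shift_between[OF 1 2] .
    then show ?thesis using True by (intro exI[of _ y']) auto
  next
    case False
    have "\<not> z !! n" using False y(1) by (simp add: sdrop_snth)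
    from zero[OF this] have 2: "sle y (sR @- sub (constw True))"
      unfolding y(1) by (simp only: sbl_Stream[OF blk] if_False)
    have 1: "sle (sR @- sub (constw False)) y" using y(2) unroll(1) by simp
    obtain y' where "y = sR @- y'" "sle (sub (constw False)) y'" "sle y' (sub (constw True))"
      using sle_shift_between[OF 1 2] .
    then show ?thesis using False by (intro exI[of _ y']) auto
  qed
  have btw: "sle (sub (constw False)) (sdrop (k * q) z) \<and> sle (sdrop (k * q) z) (sub (constw True))" for k
  proof (induction k)
    case (Suc k)
    obtain y' where y': "sdrop (k * q) z = (if sdrop (k * q) z !! 0 then tR else sR) @- y'"
      "sle (sub (constw False)) y'" "sle y' (sub (constw True))"
      using step[OF refl] Suc by blast
    have "sdrop q (sdrop (k * q) z) = y'" by (subst y'(1)) (simp add: sdrop_shift)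
    then have "sdrop (Suc k * q) z = y'" by (simp add: add.commute)
    then show ?case using y'(2,3) by (simp only:)
  next
    case 0
    then show ?case using z by simp
  qed
  have "z = sub x"
  proof (rule stream_eqI)
    fix j
    define k i where "k = j div q" and "i = j mod q"
    have i: "i < q" "j = k * q + i" using q_pos by (auto simp: k_def i_def)
    obtain y' where y': "sdrop (k * q) z = (if sdrop (k * q) z !! 0 then tR else sR) @- y'"
      using step[OF refl] btw by blast
    have "z !! j = sdrop (k * q) z !! i" by (simp add: i(2) sdrop_snth add.commute)
    also have "\<dots> = (if z !! (k * q) then tR else sR) ! i"
      using i by (subst y'(1)) (simp add: sdrop_snth)
    also have "\<dots> = sub x !! j" by (simp add: snth_sbl x_def k_def i_def)
    finally show "z !! j = sub x !! j" .
  qed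
  then show ?thesis by blast
qed

text \<open>Either some tail lies between \<open>s^inf\<close> and \<open>t^inf\<close>, and
  \<open>between_imp_sub\<close> applies to it, or \<open>outside_imp_constw\<close> makes
  \<open>z\<close> constant.\<close>

lemma desubstitute:
  assumes zero: "\<And>n. \<not> z !! n \<Longrightarrow> sle (sdrop n z) (sub (False ## constw True))"
    and one: "\<And>n. z !! n \<Longrightarrow> sle (sub (True ## constw False)) (sdrop n z)"
  shows "evper z \<or> (\<exists>n x. sdrop n z = sub x)"
proof (cases "\<exists>n. sle (sub (constw False)) (sdrop n z) \<and> sle (sdrop n z) (sub (constw True))")
  case True
  then obtain n where "sle (sub (constw False)) (sdrop n z)" "sle (sdrop n z) (sub (constw True))"
    by blast
  then have "\<exists>x. sdrop n z = sub x"
  proof (intro between_imp_sub)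
    fix m assume "\<not> sdrop n z !! m"
    then show "sle (sdrop m (sdrop n z)) (sub (False ## constw True))"
      using zero[of "n + m"] by (simp add: sdrop_snth)
  next
    fix m assume "sdrop n z !! m"
    then show "sle (sub (True ## constw False)) (sdrop m (sdrop n z))"
      using one[of "n + m"] by (simp add: sdrop_snth)
  qed
  then show ?thesis by blast
next
  case False
  have first: "\<not> sub (constw False) !! 0" "sub (constw True) !! 0"
    using snth_sbl_mult[OF blk, of "constw False" 0] snth_sbl_mult[OF blk, of "constw True" 0] by simp_all
  have "z = constw False \<or> z = constw True"
  proof (rule outside_imp_constw)
    fix n assume "\<not> z !! n"
    then have "slt (sdrop n z) (sub (constw True))" using first by (intro slt_first) (simp_all add: sdrop_snth)
    then have "sle (sdrop n z) (sub (constw True))" by (simp add: sle_def)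
    then have "\<not> sle (sub (constw False)) (sdrop n z)" using False by blast
    then show "slt (sdrop n z) (sub (constw False))" by (simp add: not_sle_iff)
  next
    fix n assume "z !! n"
    then have "slt (sub (constw False)) (sdrop n z)" using first by (intro slt_first) (simp_all add: sdrop_snth)
    then have "sle (sub (constw False)) (sdrop n z)" by (simp add: sle_def)
    then have "\<not> sle (sdrop n z) (sub (constw True))" using False by blast
    then show "slt (sub (constw True)) (sdrop n z)" by (simp add: not_sle_iff)
  qed
  then show ?thesis using evper_constw by blast
qed

end

section \<open>Sturmian words\<close>

text \<open>For irrational \<open>\<gamma>\<close> both of these are the characteristic word of slope \<open>\<gamma>\<close>. For \<open>\<gamma> = r\<close> rational
  they are chosen such that \<open>\<rho>\<^sub>r(0\<^sup>\<infinity>) = 01 cl r\<close> and \<open>\<rho>\<^sub>r(01\<^sup>\<infinity>) = 01 cu r\<close>.\<close>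

definition cl :: "real \<Rightarrow> bool stream" where
  "cl \<gamma> = smap (\<lambda>j. \<lceil>real (j + 1) * \<gamma>\<rceil> < \<lceil>real (j + 2) * \<gamma>\<rceil>) nats"

definition cu :: "real \<Rightarrow> bool stream" where
  "cu \<gamma> = smap (\<lambda>j. \<lfloor>real (j + 1) * \<gamma>\<rfloor> < \<lfloor>real (j + 2) * \<gamma>\<rfloor>) nats"

lemma cnt_cl:
  assumes "0 < \<gamma>" "\<gamma> \<le> 1" shows "cnt (cl \<gamma>) n = \<lceil>real (n + 1) * \<gamma>\<rceil> - 1"
proof (induction n)
  case 0
  have "\<lceil>\<gamma>\<rceil> = 1" using assms by (intro ceiling_unique) auto
  then show ?case by simp
next
  case (Suc n)
  have "\<lceil>real (n + 2) * \<gamma>\<rceil> \<le> \<lceil>real (n + 1) * \<gamma> + 1\<rceil>"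
    using assms by (intro ceiling_mono) (simp add: algebra_simps)
  moreover have "\<lceil>real (n + 1) * \<gamma>\<rceil> \<le> \<lceil>real (n + 2) * \<gamma>\<rceil>"
    using assms by (intro ceiling_mono mult_right_mono) auto
  moreover have "cl \<gamma> !! n = (\<lceil>real (n + 1) * \<gamma>\<rceil> < \<lceil>real (n + 2) * \<gamma>\<rceil>)"
    by (simp add: cl_def)
  ultimately show ?case using Suc by (auto simp: cnt_Suc)
qed

lemma cnt_cu:
  assumes "0 \<le> \<gamma>" "\<gamma> < 1" shows "cnt (cu \<gamma>) n = \<lfloor>real (n + 1) * \<gamma>\<rfloor>"
proof (induction n)
  case 0
  have "\<lfloor>\<gamma>\<rfloor> = 0" using assms by (intro floor_unique) auto
  then show ?case by simp
next
  case (Suc n)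
  have "\<lfloor>real (n + 2) * \<gamma>\<rfloor> \<le> \<lfloor>real (n + 1) * \<gamma> + 1\<rfloor>"
    using assms by (intro floor_mono) (simp add: algebra_simps)
  moreover have "\<lfloor>real (n + 1) * \<gamma>\<rfloor> \<le> \<lfloor>real (n + 2) * \<gamma>\<rfloor>"
    using assms by (intro floor_mono mult_right_mono) auto
  moreover have "cu \<gamma> !! n = (\<lfloor>real (n + 1) * \<gamma>\<rfloor> < \<lfloor>real (n + 2) * \<gamma>\<rfloor>)"
    by (simp add: cu_def)
  ultimately show ?case using Suc by (auto simp: cnt_Suc)
qed

text \<open>The limiting slopes 1 and 0 give \<open>01 cl 1 = 01^inf\<close> and
  \<open>01 cu 0 = 010^inf\<close>, the ends of the range in which the intervals of the next level
  lie.\<close>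

lemma cl_1: "cl 1 = constw True"
proof (rule stream_eqI)
  fix n
  have "\<lceil>real (n + 1)\<rceil> < \<lceil>real (n + 2)\<rceil>" unfolding ceiling_of_nat by simp
  then show "cl 1 !! n = constw True !! n" by (simp add: cl_def del: of_nat_add)
qed

lemma cu_0: "cu 0 = constw False"
  by (rule stream_eqI) (simp add: cu_def)

text \<open>Puts the right end \<open>01 cu\<close> of an interval before the left end
  \<open>01 cl\<close> of every interval of larger slope.\<close>

lemma sle_cu_cl:
  assumes "0 \<le> \<gamma>" "\<gamma> < \<gamma>'" "\<gamma>' \<le> 1" shows "sle (cu \<gamma>) (cl \<gamma>')"
proof (rule sle_by_cnt)
  fix n
  have "real_of_int \<lfloor>real (n + 1) * \<gamma>\<rfloor> \<le> real (n + 1) * \<gamma>" by simp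
  also have "\<dots> < real (n + 1) * \<gamma>'" using assms by simp
  also have "\<dots> \<le> real_of_int \<lceil>real (n + 1) * \<gamma>'\<rceil>" by simp
  finally show "cnt (cu \<gamma>) n \<le> cnt (cl \<gamma>') n" using assms by (simp add: cnt_cl cnt_cu)
qed

text \<open>The counts for the larger slope are never behind, and after enough letters they are
  ahead by at least 1.\<close>

lemma slt_cl:
  assumes "0 < \<gamma>" "\<gamma> < \<gamma>'" "\<gamma>' \<le> 1" shows "slt (cl \<gamma>) (cl \<gamma>')"
proof -
  have "sle (cl \<gamma>) (cl \<gamma>')"
  proof (rule sle_by_cnt)
    fix n
    have "\<lceil>real (n + 1) * \<gamma>\<rceil> \<le> \<lceil>real (n + 1) * \<gamma>'\<rceil>"
      using assms by (intro ceiling_mono mult_left_mono) auto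
    then show "cnt (cl \<gamma>) n \<le> cnt (cl \<gamma>') n" using assms by (simp add: cnt_cl)
  qed
  moreover have "cl \<gamma> \<noteq> cl \<gamma>'"
  proof
    assume eq: "cl \<gamma> = cl \<gamma>'"
    obtain n where n: "1 < real n * (\<gamma>' - \<gamma>)"
      using reals_Archimedean3[of "\<gamma>' - \<gamma>"] assms by auto
    have "\<lceil>real (n + 1) * \<gamma> + 1\<rceil> \<le> \<lceil>real (n + 1) * \<gamma>'\<rceil>"
      using n assms by (intro ceiling_mono) (simp add: algebra_simps)
    then show False using cnt_cl[of \<gamma> n] cnt_cl[of \<gamma>' n] assms eq by simp
  qed
  ultimately show ?thesis by (simp add: sle_def)
qed

text \<open>No positive multiple of an irrational number is an integer, so rounding up always
  exceeds rounding down by 1.\<close>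

lemma cl_eq_cu:
  assumes "\<gamma> \<notin> \<rat>" shows "cl \<gamma> = cu \<gamma>"
proof -
  have *: "\<lceil>real (n + 1) * \<gamma>\<rceil> = \<lfloor>real (n + 1) * \<gamma>\<rfloor> + 1" for n
  proof -
    have "real (n + 1) * \<gamma> \<notin> \<int>"
    proof
      assume "real (n + 1) * \<gamma> \<in> \<int>"
      then obtain k where "real (n + 1) * \<gamma> = of_int k" by (auto simp: Ints_def)
      then have "\<gamma> = of_int k / of_nat (n + 1)" by (simp add: field_simps)
      then show False using assms by (metis Rats_divide Rats_of_int Rats_of_nat)
    qed
    then show ?thesis by (simp add: ceiling_altdef)
       (metis Ints_of_int)
  qed
  have **: "\<lceil>real (n + 2) * \<gamma>\<rceil> = \<lfloor>real (n + 2) * \<gamma>\<rfloor> + 1" for n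
    using *[of "n + 1"] by simp
  show ?thesis unfolding cl_def cu_def * ** by (simp only: add_less_cancel_right)
qed

section \<open>One-sided limits of Sturmian words in the slope\<close>

lemma ev_left_int_part:
  assumes "0 < m"
  shows "eventually (\<lambda>r. \<lceil>real m * r\<rceil> = \<lceil>real m * \<gamma>\<rceil> \<and> \<lfloor>real m * r\<rfloor> = \<lceil>real m * \<gamma>\<rceil> - 1) (at_left \<gamma>)"
proof -
  have "((\<lambda>r. real m * r) \<longlongrightarrow> real m * \<gamma>) (at_left \<gamma>)"
    by (intro tendsto_intros)
  moreover have "real_of_int \<lceil>real m * \<gamma>\<rceil> - 1 < real m * \<gamma>" by linarith
  ultimately have "eventually (\<lambda>r. real_of_int \<lceil>real m * \<gamma>\<rceil> - 1 < real m * r) (at_left \<gamma>)"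
    by (rule order_tendstoD)
  moreover have "eventually (\<lambda>r. r < \<gamma>) (at_left \<gamma>)" by (simp add: eventually_at_filter)
  ultimately show ?thesis
  proof eventually_elim
    case (elim r)
    have "real m * r < real m * \<gamma>" using elim assms by simp
    then have "real m * r < real_of_int \<lceil>real m * \<gamma>\<rceil>" by linarith
    then show ?case using elim by (auto intro!: ceiling_unique floor_unique)
  qed
qed

lemma ev_right_int_part:
  assumes "0 < m"
  shows "eventually (\<lambda>r. \<lceil>real m * r\<rceil> = \<lfloor>real m * \<gamma>\<rfloor> + 1 \<and> \<lfloor>real m * r\<rfloor> = \<lfloor>real m * \<gamma>\<rfloor>) (at_right \<gamma>)"
proof -
  have "((\<lambda>r. real m * r) \<longlongrightarrow> real m * \<gamma>) (at_right \<gamma>)"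
    by (intro tendsto_intros)
  moreover have "real m * \<gamma> < real_of_int \<lfloor>real m * \<gamma>\<rfloor> + 1" by linarith
  ultimately have "eventually (\<lambda>r. real m * r < real_of_int \<lfloor>real m * \<gamma>\<rfloor> + 1) (at_right \<gamma>)"
    by (rule order_tendstoD)
  moreover have "eventually (\<lambda>r. \<gamma> < r) (at_right \<gamma>)" by (simp add: eventually_at_filter)
  ultimately show ?thesis
  proof eventually_elim
    case (elim r)
    have "real m * \<gamma> < real m * r" using elim assms by simp
    then have "real_of_int \<lfloor>real m * \<gamma>\<rfloor> < real m * r" by linarith
    then show ?case using elim by (auto intro!: ceiling_unique floor_unique)
  qed
qed

text \<open>A prefix of length \<open>k\<close> involves only the multiples 1 to
  \<open>k + 1\<close> of the slope, and the integer parts of each are constant just left of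
  \<gamma>. Both words converge to \<open>cl \<gamma>\<close> from the left and, dually, to
  \<open>cu \<gamma>\<close> from the right.\<close>

lemma ev_left_stake:
  "eventually (\<lambda>r. stake k (cl r) = stake k (cl \<gamma>) \<and> stake k (cu r) = stake k (cl \<gamma>)) (at_left \<gamma>)"
proof -
  have "eventually (\<lambda>r. \<forall>m\<in>{1..k+1}. \<lceil>real m * r\<rceil> = \<lceil>real m * \<gamma>\<rceil> \<and> \<lfloor>real m * r\<rfloor> = \<lceil>real m * \<gamma>\<rceil> - 1) (at_left \<gamma>)"
    by (intro eventually_ball_finite ballI ev_left_int_part) auto
  then show ?thesis
  proof eventually_elim
    case (elim r)
    have "\<lceil>real (j + 1) * r\<rceil> = \<lceil>real (j + 1) * \<gamma>\<rceil> \<and> \<lfloor>real (j + 1) * r\<rfloor> = \<lceil>real (j + 1) * \<gamma>\<rceil> - 1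
       \<and> \<lceil>real (j + 2) * r\<rceil> = \<lceil>real (j + 2) * \<gamma>\<rceil> \<and> \<lfloor>real (j + 2) * r\<rfloor> = \<lceil>real (j + 2) * \<gamma>\<rceil> - 1"
      if "j < k" for j
      using bspec[OF elim, of "j + 1"] bspec[OF elim, of "j + 2"] that
      by (simp del: of_nat_add of_nat_Suc)
    then show ?case unfolding cl_def cu_def
      by (auto intro!: nth_equalityI simp del: of_nat_add of_nat_Suc add_2_eq_Suc' Suc_eq_plus1[symmetric])
  qed
qed

lemma ev_right_stake:
  "eventually (\<lambda>r. stake k (cl r) = stake k (cu \<gamma>) \<and> stake k (cu r) = stake k (cu \<gamma>)) (at_right \<gamma>)"
proof -
  have "eventually (\<lambda>r. \<forall>m\<in>{1..k+1}. \<lceil>real m * r\<rceil> = \<lfloor>real m * \<gamma>\<rfloor> + 1 \<and> \<lfloor>real m * r\<rfloor> = \<lfloor>real m * \<gamma>\<rfloor>) (at_right \<gamma>)"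
    by (intro eventually_ball_finite ballI ev_right_int_part) auto
  then show ?thesis
  proof eventually_elim
    case (elim r)
    have "\<lceil>real (j + 1) * r\<rceil> = \<lfloor>real (j + 1) * \<gamma>\<rfloor> + 1 \<and> \<lfloor>real (j + 1) * r\<rfloor> = \<lfloor>real (j + 1) * \<gamma>\<rfloor>
       \<and> \<lceil>real (j + 2) * r\<rceil> = \<lfloor>real (j + 2) * \<gamma>\<rfloor> + 1 \<and> \<lfloor>real (j + 2) * r\<rfloor> = \<lfloor>real (j + 2) * \<gamma>\<rfloor>"
      if "j < k" for j
      using bspec[OF elim, of "j + 1"] bspec[OF elim, of "j + 2"] that
      by (simp del: of_nat_add of_nat_Suc)
    then show ?case unfolding cl_def cu_def
      by (auto intro!: nth_equalityI simp del: of_nat_add of_nat_Suc add_2_eq_Suc' Suc_eq_plus1[symmetric])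
  qed
qed

lemma unit_rat_between:
  fixes a b :: real assumes "0 \<le> a" "a < b" "b \<le> 1"
  obtains r where "r \<in> unit_rats" "a < of_rat r" "of_rat r < b"
proof -
  obtain r where "a < of_rat r" "of_rat r < b" using of_rat_dense assms by blast
  moreover have "0 < real_of_rat r" "real_of_rat r < 1" using calculation assms by linarith+
  ultimately show ?thesis using that[of r] by simp
qed

lemma cl_left_approx:
  fixes \<gamma> :: real assumes "0 < \<gamma>"
  obtains a where "0 \<le> a" "a < \<gamma>"
    "\<And>x. a < x \<Longrightarrow> x < \<gamma> \<Longrightarrow> stake k (cl x) = stake k (cl \<gamma>) \<and> stake k (cu x) = stake k (cl \<gamma>)"
proof -
  obtain b where "b < \<gamma>"
    "\<And>x. b < x \<Longrightarrow> x < \<gamma> \<Longrightarrow> stake k (cl x) = stake k (cl \<gamma>) \<and> stake k (cu x) = stake k (cl \<gamma>)"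
    using ev_left_stake[of k \<gamma>] unfolding eventually_at_left_field by auto
  then show ?thesis using that[of "max 0 b"] assms by simp
qed

lemma cu_right_approx:
  fixes \<gamma> :: real assumes "\<gamma> < 1"
  obtains a where "a \<le> 1" "\<gamma> < a"
    "\<And>x. \<gamma> < x \<Longrightarrow> x < a \<Longrightarrow> stake k (cl x) = stake k (cu \<gamma>) \<and> stake k (cu x) = stake k (cu \<gamma>)"
proof -
  obtain b where "\<gamma> < b"
    "\<And>x. \<gamma> < x \<Longrightarrow> x < b \<Longrightarrow> stake k (cl x) = stake k (cu \<gamma>) \<and> stake k (cu x) = stake k (cu \<gamma>)"
    using ev_right_stake[of k \<gamma>] unfolding eventually_at_right_field by auto
  then show ?thesis using that[of "min 1 b"] assms by simp
qed

lemma ceiling_divide_nat: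
  assumes "0 < q" shows "\<lceil>real a / real q\<rceil> = int ((a + q - 1) div q)"
proof (rule ceiling_unique)
  define N where "N = (a + q - 1) div q"
  have "q * N \<le> a + q - 1" "a + q - 1 < q + q * N"
    using dividend_less_times_div[OF assms, of "a + q - 1"] by (simp_all add: N_def)
  then have "q * N < a + q" "a \<le> q * N" using assms by linarith+
  then have "real q * real N < real a + real q" "real a \<le> real q * real N"
    by (simp_all flip: of_nat_mult of_nat_add)
  then show "real_of_int (int N) - 1 < real a / real q" "real a / real q \<le> real_of_int (int N)"
    using assms by (simp_all add: field_simps)
qed

context slope
begin

lemma slope_bounds: "0 < real p / real q" "real p / real q < 1"
  using p_pos p_less by auto

lemma ceiling_slope: "\<lceil>real (n + 1) * (real p / real q)\<rceil> = int ((Suc n * p + q - 1) div q)"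
proof -
  have "real (n + 1) * (real p / real q) = real (Suc n * p) / real q"
    by (simp add: distrib_right)
  then show ?thesis by (simp only: ceiling_divide_nat[OF q_pos])
qed

lemma floor_slope: "\<lfloor>real (n + 1) * (real p / real q)\<rfloor> = int (Suc n * p div q)"
proof -
  have "real (n + 1) * (real p / real q) = real (Suc n * p) / real q"
    by (simp add: distrib_right)
  then show ?thesis by (simp only: floor_divide_of_nat_eq)
qed

lemma cnt_sub_start:
  "cnt (sub x) (Suc 0) = of_bool (x !! 0)"
  using cnt_sub[of x 0] q_pos by auto

lemma sub_zeros: "sub (constw False) = False ## True ## cl (real p / real q)"
proof (rule eq_by_cnt)
  fix i
  consider "i = 0" | "i = Suc 0" | j where "i = Suc (Suc j)" by (metis not0_implies_Suc)
  then show "cnt (sub (constw False)) i = cnt (False ## True ## cl (real p / real q)) i"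
  proof cases
    case 3
    have "cnt (cl (real p / real q)) j = \<lceil>real (j + 1) * (real p / real q)\<rceil> - 1"
      using slope_bounds by (intro cnt_cl) auto
    then show ?thesis unfolding ceiling_slope by (simp add: 3 cnt_Stream cnt_sub_zeros)
  qed (simp_all add: cnt_sub_start cnt_Stream)
qed

text \<open>Past its first block the image has the upper counts of \<open>cnt_sub_bounds\<close>;
  inside that block, beyond its first letter, upper and lower counts coincide by
  \<open>unaligned_div\<close>.\<close>

lemma sub_zero_ones: "sub (False ## constw True) = False ## True ## cu (real p / real q)"
proof (rule eq_by_cnt)
  fix i
  consider "i = 0" | "i = Suc 0" | j where "i = Suc (Suc j)" by (metis not0_implies_Suc)
  then show "cnt (sub (False ## constw True)) i = cnt (False ## True ## cu (real p / real q)) i"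
  proof cases
    case 3
    have c: "cnt (cu (real p / real q)) j = \<lfloor>real (j + 1) * (real p / real q)\<rfloor>"
      using slope_bounds by (intro cnt_cu) auto
    have "cnt (sub (False ## constw True)) i = int ((Suc j * p + q) div q)"
    proof (cases "Suc j < q")
      case True
      then have "\<not> q dvd Suc j" using nat_dvd_not_less by blast
      from unaligned_div[OF this] show ?thesis using True 3 cnt_sub[of "False ## constw True" "Suc j"] by simp
    next
      case False
      then obtain k where "Suc j div q = Suc k"
        using q_pos by (metis div_greater_zero_iff gr0_implies_Suc not_less)
      then show ?thesis using 3 cnt_sub[of "False ## constw True" "Suc j"] q_pos by simp
    qed
    also have "\<dots> = 1 + int (Suc j * p div q)" using q_pos by simp
    finally show ?thesis using c unfolding floor_slope by (simp add: 3 cnt_Stream)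
  qed (simp_all add: cnt_sub_start cnt_Stream)
qed

lemma sub_one_zeros: "sub (True ## constw False) = True ## False ## cl (real p / real q)"
proof (rule eq_by_cnt)
  fix i
  consider "i = 0" | "i = Suc 0" | j where "i = Suc (Suc j)" by (metis not0_implies_Suc)
  then show "cnt (sub (True ## constw False)) i = cnt (True ## False ## cl (real p / real q)) i"
  proof cases
    case 3
    have c: "cnt (cl (real p / real q)) j = \<lceil>real (j + 1) * (real p / real q)\<rceil> - 1"
      using slope_bounds by (intro cnt_cl) auto
    have "cnt (sub (True ## constw False)) i = int ((Suc j * p + q - 1) div q)"
    proof (cases "Suc j < q")
      case True
      then have "\<not> q dvd Suc j" using nat_dvd_not_less by blast
      from unaligned_div[OF this] show ?thesis using True 3 cnt_sub[of "True ## constw False" "Suc j"] q_pos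
        by simp
    next
      case False
      then obtain k where "Suc j div q = Suc k"
        using q_pos by (metis div_greater_zero_iff gr0_implies_Suc not_less)
      then show ?thesis using 3 cnt_sub[of "True ## constw False" "Suc j"] by simp
    qed
    then show ?thesis using c unfolding ceiling_slope by (simp add: 3 cnt_Stream)
  qed (simp_all add: cnt_sub_start cnt_Stream)
qed

text \<open>By the formulas for the images, \<open>sR\<close> begins with 01 and \<open>tR\<close>
  with 10.\<close>

lemma both_letters: "True \<in> set sR" "False \<in> set sR" "True \<in> set tR" "False \<in> set tR"
proof -
  have "sub x !! j \<in> set (if x !! (j div q) then tR else sR)" for x j
    using q_pos by (simp add: snth_sbl)
  from this[of "constw False" 0] this[of "constw False" 1] this[of "True ## constw False" 0]
    this[of "True ## constw False" 1]
  show "True \<in> set sR" "False \<in> set sR" "True \<in> set tR" "False \<in> set tR"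
    using p_pos p_less by (simp_all add: sub_zeros sub_one_zeros)
qed

end

section \<open>Iterated substitutions\<close>

text \<open>The composed substitution on infinite words, written as a single one with blocks
  \<open>s_n\<close> and \<open>t_n\<close> so that the results on \<open>blk\<close> pairs apply to
  it directly.\<close>

definition wsub :: "rat list \<Rightarrow> bool stream \<Rightarrow> bool stream" where
  "wsub rs = sbl (sw rs) (tw rs)"

lemma slope_rat:
  assumes "r \<in> unit_rats"
  shows "slope (rat_num r) (rat_den r)"
    and "omega_minus r = slope.sR (rat_num r) (rat_den r)"
    and "omega_plus r = slope.tR (rat_num r) (rat_den r)"
proof -
  show *: "slope (rat_num r) (rat_den r)"
    by (rule slope.intro) (rule rat_num_den[OF assms])+
  show "omega_minus r = slope.sR (rat_num r) (rat_den r)"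
    "omega_plus r = slope.tR (rat_num r) (rat_den r)"
    unfolding slope.sR_def[OF *] slope.tR_def[OF *]
    using omega_minus_eq[OF assms] omega_plus_eq[OF assms] .
qed

lemma blk_omega:
  assumes "r \<in> unit_rats" shows "blk (omega_minus r) (omega_plus r)"
  unfolding slope_rat(2,3)[OF assms] by (rule slope.blk[OF slope_rat(1)[OF assms]])

lemma length_omega:
  assumes "r \<in> unit_rats" shows "length (omega_minus r) = rat_den r" "2 \<le> rat_den r"
  using slope.length_sR[OF slope_rat(1)[OF assms]] rat_num_den(1,2)[OF assms]
  by (simp_all add: slope_rat(2)[OF assms])

lemma omega_both_letters:
  assumes "r \<in> unit_rats" shows "c \<in> set (omega_minus r) \<and> c \<in> set (omega_plus r)"
  unfolding slope_rat(2,3)[OF assms]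
  using slope.both_letters[OF slope_rat(1)[OF assms]] by (cases c) simp_all

lemma foldr_rho: "foldr rho rs w = sb (sw rs) (tw rs) w"
proof (induction rs)
  case Nil
  show ?case unfolding sw_def tw_def by (induction w) auto
next
  case (Cons r rs)
  have *: "rho r u = sb (omega_minus r) (omega_plus r) u" for u by (simp add: rho_def sb_def)
  show ?case using Cons by (simp add: sw_def tw_def * sb_sb)
qed

lemma sw_append: "sw (rs @ rs') = sb (sw rs) (tw rs) (sw rs')"
  and tw_append: "tw (rs @ rs') = sb (sw rs) (tw rs) (tw rs')"
  by (simp_all add: sw_def[of "rs @ rs'"] tw_def[of "rs @ rs'"] foldr_rho[symmetric] sw_def[of rs'] tw_def[of rs'])

lemma sw_single [simp]: "sw [r] = omega_minus r" and tw_single [simp]: "tw [r] = omega_plus r"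
  by (simp_all add: sw_def tw_def rho_def)

lemma sw_Nil [simp]: "sw [] = [False]" and tw_Nil [simp]: "tw [] = [True]"
  by (simp_all add: sw_def tw_def)

lemma blk_sw: "set rs \<subseteq> unit_rats \<Longrightarrow> blk (sw rs) (tw rs)"
proof (induction rs)
  case Nil
  then show ?case by (simp add: blk_def)
next
  case (Cons r rs)
  then show ?case using sw_append[of "[r]" rs] tw_append[of "[r]" rs] blk_sb blk_omega by auto
qed

lemma wsub_append:
  "set (rs @ rs') \<subseteq> unit_rats \<Longrightarrow> wsub (rs @ rs') x = wsub rs (wsub rs' x)"
  unfolding wsub_def using sbl_sbl[OF blk_sw blk_sw, of rs rs'] by (simp add: sw_append tw_append)

lemma wsub_Nil [simp]: "wsub [] x = x"
  by (rule stream_eqI) (simp add: wsub_def snth_sbl)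

lemma wsub_single:
  assumes "r \<in> unit_rats"
  shows "wsub [r] (constw False) = False ## True ## cl (of_rat r)"
    and "wsub [r] (False ## constw True) = False ## True ## cu (of_rat r)"
    and "wsub [r] (True ## constw False) = True ## False ## cl (of_rat r)"
proof -
  note s = slope_rat[OF assms]
  note * = rat_num_den(4)[OF assms]
  show "wsub [r] (constw False) = False ## True ## cl (of_rat r)"
    "wsub [r] (False ## constw True) = False ## True ## cu (of_rat r)"
    "wsub [r] (True ## constw False) = True ## False ## cl (of_rat r)"
    using slope.sub_zeros[OF s(1)] slope.sub_zero_ones[OF s(1)] slope.sub_one_zeros[OF s(1)]
    by (simp_all add: wsub_def s(2,3) *)
qed

text \<open>Expresses the last substitution by its slope, so that \<open>r\<close> can vary while
  \<open>rs\<close> stays fixed.\<close>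

lemma wsub_snoc:
  assumes "set rs \<subseteq> unit_rats" "r \<in> unit_rats"
  shows "wsub (rs @ [r]) (constw False) = wsub rs (False ## True ## cl (of_rat r))"
    and "wsub (rs @ [r]) (False ## constw True) = wsub rs (False ## True ## cu (of_rat r))"
    and "wsub (rs @ [r]) (True ## constw False) = wsub rs (True ## False ## cl (of_rat r))"
  using assms wsub_single[OF assms(2)] wsub_append[of rs "[r]"] by simp_all

lemma sle_wsub_iff: "set rs \<subseteq> unit_rats \<Longrightarrow> sle (wsub rs x) (wsub rs y) \<longleftrightarrow> sle x y"
  and slt_wsub_iff: "set rs \<subseteq> unit_rats \<Longrightarrow> slt (wsub rs x) (wsub rs y) \<longleftrightarrow> slt x y"
  unfolding wsub_def using sle_sbl_iff slt_sbl_iff blk_sw by blast+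

lemma wsub_val_mono: "set rs \<subseteq> unit_rats \<Longrightarrow> sle x y \<Longrightarrow> val (wsub rs x) \<le> val (wsub rs y)"
  using sle_wsub_iff sle_val_le by blast

lemma wsub_first: "set rs \<subseteq> unit_rats \<Longrightarrow> wsub rs x !! 0 = x !! 0"
  using snth_sbl_mult[OF blk_sw, of rs x 0] by (simp only: wsub_def mult_0)

lemma wsub_Stream:
  "set rs \<subseteq> unit_rats \<Longrightarrow> wsub rs (c ## x) = (if c then tw rs else sw rs) @- wsub rs x"
  unfolding wsub_def using sbl_Stream blk_sw by blast

lemma wsub_words:
  assumes "set rs \<subseteq> unit_rats"
  shows "wsub rs (constw False) = cycle (sw rs)"
    and "wsub rs (False ## constw True) = sw rs @- cycle (tw rs)"
    and "wsub rs (True ## constw False) = tw rs @- cycle (sw rs)"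
    and "wsub rs (False ## True ## constw False) = sw rs @- tw rs @- cycle (sw rs)"
    and "wsub rs (True ## False ## constw True) = tw rs @- sw rs @- cycle (tw rs)"
proof -
  have *: "wsub rs (constw False) = cycle (sw rs)" "wsub rs (constw True) = cycle (tw rs)"
    unfolding wsub_def using sbl_constw[OF blk_sw[OF assms]] by simp_all
  show "wsub rs (constw False) = cycle (sw rs)"
    "wsub rs (False ## constw True) = sw rs @- cycle (tw rs)"
    "wsub rs (True ## constw False) = tw rs @- cycle (sw rs)"
    "wsub rs (False ## True ## constw False) = sw rs @- tw rs @- cycle (sw rs)"
    "wsub rs (True ## False ## constw True) = tw rs @- sw rs @- cycle (tw rs)"
    using wsub_Stream[OF assms] * by simp_all
qed

lemma wsub_infinitely_many:
  assumes "set rs \<subseteq> unit_rats" "rs \<noteq> []" shows "\<exists>m\<ge>n. wsub rs x !! m = c"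
proof -
  obtain r rs' where rs: "rs = r # rs'" using assms by (cases rs) auto
  have "wsub rs x = sbl (omega_minus r) (omega_plus r) (wsub rs' x)"
    using wsub_append[of "[r]" rs' x] assms by (simp add: rs wsub_def)
  moreover have r: "r \<in> unit_rats" using assms rs by auto
  ultimately show ?thesis
    using sbl_infinitely_many[OF blk_omega[OF r]] omega_both_letters[OF r] by simp
qed

lemma wsub_snth_cong:
  assumes "set rs \<subseteq> unit_rats" "\<And>i. i < k \<Longrightarrow> x !! i = y !! i" "i < k"
  shows "wsub rs x !! i = wsub rs y !! i"
proof -
  have "i div length (sw rs) < k" using assms(3) div_le_dividend le_less_trans by blast
  then show ?thesis using assms(2) by (simp add: wsub_def snth_sbl)
qed

text \<open>Crude but uniform in \<open>rs\<close>: blocks have length at least 1, so a common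
  prefix never gets shorter under substitution.\<close>

lemma wsub_close:
  assumes rs: "set rs \<subseteq> unit_rats" and eq: "stake k x = stake k y"
  shows "\<bar>val (wsub rs (c ## d ## x)) - val (wsub rs (c ## d ## y))\<bar> \<le> 1 / 2 ^ k"
proof -
  define x' y' where "x' = c ## d ## x" and "y' = c ## d ## y"
  have nth: "x' !! j = y' !! j" if "j < k" for j
  proof -
    consider "j = 0" | "j = Suc 0" | l where "j = Suc (Suc l)" by (metis not0_implies_Suc)
    then show ?thesis
    proof cases
      case 3
      have "stake k x ! l = stake k y ! l" by (simp only: eq)
      then show ?thesis using that 3 by (simp add: x'_def y'_def)
    qed (simp_all add: x'_def y'_def)
  qed
  have "wsub rs x' !! i = wsub rs y' !! i" if "i < k" for i
    using nth that by (rule wsub_snth_cong[OF rs])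
  then have "stake k (wsub rs x') = stake k (wsub rs y')"
    by (intro nth_equalityI) simp_all
  then show ?thesis unfolding x'_def y'_def by (rule val_close)
qed

text \<open>Monotonicity reduces this to the outermost rational, with its words
  \<open>01 cl r\<close> and \<open>01 cu r\<close>, where \<open>cl r\<close> contains a 1 and
  \<open>cu r\<close> a 0.\<close>

lemma wsub_range:
  assumes "set rs \<subseteq> unit_rats" "rs \<noteq> []"
  shows "1/4 < val (wsub rs (constw False))" "val (wsub rs (False ## constw True)) < 1/2"
proof -
  obtain r rs' where rs: "rs = r # rs'" using assms by (cases rs) auto
  have r: "r \<in> unit_rats" "set rs' \<subseteq> unit_rats" "set [r] \<subseteq> unit_rats" using assms rs by auto
  have eq: "wsub rs x = wsub [r] (wsub rs' x)" for x
    using wsub_append[of "[r]" rs'] assms rs by simp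
  have "\<exists>m\<ge>2. wsub [r] (constw False) !! m" using wsub_infinitely_many[OF r(3), of 2 _ True] by auto
  then obtain m where "m \<ge> 2" "(False ## True ## cl (of_rat r)) !! m"
    using wsub_single(1)[OF r(1)] by auto
  then have "cl (of_rat r) !! (m - 2)" by (cases m; cases "m - 1") auto
  then have "1/4 < val (wsub [r] (constw False))"
    using val_pos[of "cl (of_rat r)"] by (simp add: wsub_single(1)[OF r(1)] val_Stream)
  also have "\<dots> \<le> val (wsub rs (constw False))"
    unfolding eq by (intro wsub_val_mono r constw_least)
  finally show "1/4 < val (wsub rs (constw False))" .
  have "\<exists>m\<ge>2. \<not> wsub [r] (False ## constw True) !! m" using wsub_infinitely_many[OF r(3), of 2 _ False] by auto
  then obtain m where "m \<ge> 2" "\<not> (False ## True ## cu (of_rat r)) !! m"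
    using wsub_single(2)[OF r(1)] by auto
  then have "\<not> cu (of_rat r) !! (m - 2)" by (cases m; cases "m - 1") auto
  then have *: "val (wsub [r] (False ## constw True)) < 1/2"
    using val_less_1[of "cu (of_rat r)"] by (simp add: wsub_single(2)[OF r(1)] val_Stream)
  have "sle (wsub rs' (False ## constw True)) (False ## constw True)"
  proof -
    obtain c y where y: "wsub rs' (False ## constw True) = c ## y" by (cases "wsub rs' (False ## constw True)")
    have "\<not> c" using wsub_first[OF r(2), of "False ## constw True"] y by simp
    then show ?thesis by (simp add: y sle_Cons constw_greatest)
  qed
  then have "val (wsub rs (False ## constw True)) \<le> val (wsub [r] (False ## constw True))"
    unfolding eq by (intro wsub_val_mono r)
  with * show "val (wsub rs (False ## constw True)) < 1/2" by simp
qed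

lemma sdrop_unfold: "sdrop n x = x !! n ## sdrop (Suc n) x"
  by (rule stream.expand) simp

text \<open>Induction from the outermost rational: a tail at a block boundary is the image of a tail
  of the inner word, and any other tail is bounded by \<open>s^inf\<close> or \<open>t^inf\<close>
  through \<open>unaligned_zero\<close> and \<open>unaligned_one\<close>.\<close>

lemma wsub_tails:
  assumes "set rs \<subseteq> unit_rats"
  shows "\<not> wsub rs x !! n \<Longrightarrow> sle (sdrop n (wsub rs x)) (wsub rs (False ## constw True))"
    and "wsub rs x !! n \<Longrightarrow> sle (wsub rs (True ## constw False)) (sdrop n (wsub rs x))"
  using assms
proof (induction rs arbitrary: n)
  case Nil
  { case 1
    then have "sle (sdrop n x) (False ## constw True)"
      by (subst sdrop_unfold) (simp add: sle_Cons constw_greatest del: sdrop.simps)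
    then show ?case by simp
  next
    case 2
    then have "sle (True ## constw False) (sdrop n x)"
      by (subst sdrop_unfold) (simp add: sle_Cons constw_least del: sdrop.simps)
    then show ?case by simp
  }
next
  case (Cons r rs)
  have r: "r \<in> unit_rats" "set rs \<subseteq> unit_rats" if "set (r # rs) \<subseteq> unit_rats"
    using that by auto
  define q where "q = rat_den r"
  define y where "y = wsub rs x"
  have eq: "wsub (r # rs) z = sbl (omega_minus r) (omega_plus r) (wsub rs z)"
    if "set (r # rs) \<subseteq> unit_rats" for z
    using wsub_append[of "[r]" rs] that by (simp add: wsub_def)
  { case 1
    note r = r[OF 1(2)] and eq = eq[OF 1(2)]
    note S = slope_rat(1)[OF r(1)] and om = slope_rat(2,3)[OF r(1)] and b = blk_omega[OF r(1)]
    have len: "length (omega_minus r) = q" using length_omega r(1) q_def by simp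
    show ?case
    proof (cases "q dvd n")
      case True
      then obtain k where k: "n = k * q" by (metis dvd_def mult.commute)
      have "\<not> y !! k" using 1(1) snth_sbl_mult[OF b, of y k] unfolding eq len k y_def by simp
      then have "sle (sdrop k y) (wsub rs (False ## constw True))"
        using Cons.IH(1)[of k] r unfolding y_def by blast
      then show ?thesis unfolding eq using sdrop_sbl[OF b, of k y] sle_sbl_iff[OF b]
        by (simp add: k len y_def)
    next
      case False
      then have "sle (sdrop n (wsub (r # rs) x)) (sbl (omega_minus r) (omega_plus r) (constw False))"
        using slope.unaligned_zero[OF S] 1(1) unfolding eq om q_def by blast
      also have "sle (sbl (omega_minus r) (omega_plus r) (constw False)) (wsub (r # rs) (False ## constw True))"
        unfolding eq by (intro sle_sbl b constw_least)
      finally (sle_trans) show ?thesis .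
    qed
  next
    case 2
    note r = r[OF 2(2)] and eq = eq[OF 2(2)]
    note S = slope_rat(1)[OF r(1)] and om = slope_rat(2,3)[OF r(1)] and b = blk_omega[OF r(1)]
    have len: "length (omega_minus r) = q" using length_omega r(1) q_def by simp
    show ?case
    proof (cases "q dvd n")
      case True
      then obtain k where k: "n = k * q" by (metis dvd_def mult.commute)
      have "y !! k" using 2(1) snth_sbl_mult[OF b, of y k] unfolding eq len k y_def by simp
      then have "sle (wsub rs (True ## constw False)) (sdrop k y)"
        using Cons.IH(2)[of k] r unfolding y_def by blast
      then show ?thesis unfolding eq using sdrop_sbl[OF b, of k y] sle_sbl_iff[OF b]
        by (simp add: k len y_def)
    next
      case False
      then have *: "sle (sbl (omega_minus r) (omega_plus r) (constw True)) (sdrop n (wsub (r # rs) x))"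
        using slope.unaligned_one[OF S] 2(1) unfolding eq om q_def by blast
      have "sle (wsub (r # rs) (True ## constw False)) (sbl (omega_minus r) (omega_plus r) (constw True))"
        unfolding eq by (intro sle_sbl b constw_greatest)
      then show ?thesis using * sle_trans by blast
    qed
  }
qed

text \<open>Converse of \<open>wsub_tails\<close> up to a finite prefix and eventually periodic
  words. One substitution is removed at a time: bounds at block boundaries pass to the source word
  because \<open>sbl\<close> preserves and reflects the order.\<close>

lemma wsub_desubstitute:
  assumes "set rs \<subseteq> unit_rats"
    and "\<And>n. \<not> z !! n \<Longrightarrow> sle (sdrop n z) (wsub rs (False ## constw True))"
    and "\<And>n. z !! n \<Longrightarrow> sle (wsub rs (True ## constw False)) (sdrop n z)"
  shows "evper z \<or> (\<exists>n x. sdrop n z = wsub rs x)"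
  using assms
proof (induction rs arbitrary: z)
  case Nil
  have "sdrop 0 z = wsub [] z" by simp
  then show ?case by blast
next
  case (Cons r rs)
  have r: "r \<in> unit_rats" "set rs \<subseteq> unit_rats" using Cons.prems(1) by auto
  note S = slope_rat(1)[OF r(1)] and om = slope_rat(2,3)[OF r(1)] and b = blk_omega[OF r(1)]
  have eq: "wsub (r # rs) z = sbl (omega_minus r) (omega_plus r) (wsub rs z)" for z
    using wsub_append[of "[r]" rs] Cons.prems(1) by (simp add: wsub_def)
  \<comment> \<open>The bounds for the whole list are at least as strict as those for
    \<open>r\<close> alone.\<close>
  have first: "sle (wsub rs (False ## constw True)) (False ## constw True)"
    "sle (True ## constw False) (wsub rs (True ## constw False))"
    using wsub_first[OF r(2), of "False ## constw True"] wsub_first[OF r(2), of "True ## constw False"]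
    by (cases "wsub rs (False ## constw True)", simp add: sle_Cons constw_greatest,
        cases "wsub rs (True ## constw False)", simp add: sle_Cons constw_least)
  have "evper z \<or> (\<exists>n x. sdrop n z = sbl (omega_minus r) (omega_plus r) x)"
    unfolding om
  proof (rule slope.desubstitute[OF S])
    fix n assume "\<not> z !! n"
    then show "sle (sdrop n z) (slope.sub (rat_num r) (rat_den r) (False ## constw True))"
      using Cons.prems(2)[of n] sle_sbl[OF b first(1)] sle_trans unfolding eq om by blast
  next
    fix n assume "z !! n"
    then show "sle (slope.sub (rat_num r) (rat_den r) (True ## constw False)) (sdrop n z)"
      using Cons.prems(3)[of n] sle_sbl[OF b first(2)] sle_trans unfolding eq om by blast
  qed
  moreover have ?case if z: "sdrop n z = sbl (omega_minus r) (omega_plus r) x" for n x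
  proof -
    define q where "q = length (omega_minus r)"
    have dr: "sdrop (n + k * q) z = sbl (omega_minus r) (omega_plus r) (sdrop k x)" for k
      using sdrop_sbl[OF b, of k x] by (simp add: q_def z[symmetric])
    have hd: "z !! (n + k * q) = x !! k" for k
      using snth_sbl_mult[OF b, of x k] unfolding z[symmetric] q_def by (simp add: sdrop_snth)
    have "evper x \<or> (\<exists>n y. sdrop n x = wsub rs y)"
    proof (rule Cons.IH[OF r(2)])
      fix k assume "\<not> x !! k"
      then have "sle (sdrop (n + k * q) z) (wsub (r # rs) (False ## constw True))"
        using Cons.prems(2) hd by blast
      then show "sle (sdrop k x) (wsub rs (False ## constw True))"
        unfolding dr eq sle_sbl_iff[OF b] .
    next
      fix k assume "x !! k"
      then have "sle (wsub (r # rs) (True ## constw False)) (sdrop (n + k * q) z)"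
        using Cons.prems(3) hd by blast
      then show "sle (wsub rs (True ## constw False)) (sdrop k x)"
        unfolding dr eq sle_sbl_iff[OF b] .
    qed
    then show ?case
    proof
      assume "evper x"
      then have "evper (sdrop n z)" unfolding z by (rule evper_sbl[OF b])
      then show ?case using evper_sdrop by blast
    next
      assume "\<exists>k y. sdrop k x = wsub rs y"
      then obtain k y where "sdrop k x = wsub rs y" by blast
      then have "sdrop (n + k * q) z = wsub (r # rs) y" unfolding dr eq by simp
      then show ?case by blast
    qed
  qed
  ultimately show ?case by blast
qed

section \<open>Countable and uncountable survivor sets\<close>

text \<open>Reduces countability for a hole bounded by images under \<open>wsub rs\<close> to a
  statement about the source words \<open>A\<close> and \<open>B\<close>: itineraries are
  desubstituted, and the bounds carry over.\<close>

lemma countable_survivors_wsub: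
  assumes rs: "set rs \<subseteq> unit_rats" "rs \<noteq> []" and first: "\<not> A !! 0" "B !! 0"
    and AB: "\<And>x. \<lbrakk>\<And>n. \<not> x !! n \<Longrightarrow> sle (sdrop n x) A; \<And>n. x !! n \<Longrightarrow> slt B (sdrop n x)\<rbrakk> \<Longrightarrow> evper x"
    and a: "a \<le> val (wsub rs A)" "a < 1/2" and b: "val (wsub rs B) < b"
  shows "countable (survivors a b)"
proof (rule countable_survivors[OF _ _ a b])
  show "wsub rs B !! 0" using first wsub_first[OF rs(1)] by blast
  show "\<exists>m\<ge>n. \<not> wsub rs A !! m" for n
    using wsub_infinitely_many[OF rs, of n A False] by simp
  fix z
  assume zero: "\<And>n. \<not> z !! n \<Longrightarrow> sle (sdrop n z) (wsub rs A)"
    and one: "\<And>n. z !! n \<Longrightarrow> slt (wsub rs B) (sdrop n z)"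
  have le: "sle A (False ## constw True)" "sle (True ## constw False) B"
    using first by (cases A, simp add: sle_Cons constw_greatest, cases B, simp add: sle_Cons constw_least)
  have "evper z \<or> (\<exists>n x. sdrop n z = wsub rs x)"
  proof (rule wsub_desubstitute[OF rs(1)])
    fix n assume "\<not> z !! n"
    then show "sle (sdrop n z) (wsub rs (False ## constw True))"
      using zero[of n] le(1) sle_wsub_iff[OF rs(1)] sle_trans by blast
  next
    fix n assume "z !! n"
    then have "sle (wsub rs B) (sdrop n z)" using one by (simp add: sle_def)
    then show "sle (wsub rs (True ## constw False)) (sdrop n z)"
      using le(2) sle_wsub_iff[OF rs(1)] sle_trans by blast
  qed
  moreover have "evper z" if z: "sdrop n z = wsub rs x" for n x
  proof -
    note b = blk_sw[OF rs(1)]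
    define q where "q = length (sw rs)"
    have dr: "sdrop (n + k * q) z = wsub rs (sdrop k x)" for k
      using sdrop_sbl[OF b, of k x] by (simp add: q_def wsub_def[symmetric] z[symmetric])
    have hd: "z !! (n + k * q) = x !! k" for k
      using snth_sbl_mult[OF b, of x k] unfolding wsub_def[symmetric] z[symmetric] q_def
      by (simp add: sdrop_snth)
    have "evper x"
    proof (rule AB)
      fix k assume "\<not> x !! k"
      then have "sle (sdrop (n + k * q) z) (wsub rs A)" using zero hd by blast
      then show "sle (sdrop k x) A" unfolding dr sle_wsub_iff[OF rs(1)] .
    next
      fix k assume "x !! k"
      then have "slt (wsub rs B) (sdrop (n + k * q) z)" using one hd by blast
      then show "slt B (sdrop k x)" unfolding dr slt_wsub_iff[OF rs(1)] .
    qed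
    then have "evper (sdrop n z)" unfolding z wsub_def by (rule evper_sbl[OF b])
    then show ?thesis by (rule evper_sdrop)
  qed
  ultimately show "evper z" by blast
qed

lemma eventually_const_evper:
  assumes "\<And>m. n \<le> m \<Longrightarrow> x !! m = c" shows "evper x"
proof -
  have "sdrop n x = constw c" by (rule stream_eqI) (simp add: sdrop_snth assms)
  then show ?thesis using evper_sdrop evper_constw by metis
qed

text \<open>If 01 occurred in the source word, the bound at the 0 would make the rest after it at
  most \<open>0^inf\<close>, while the strict bound at the 1 makes it larger. So a 0 is followed by
  zeros only.\<close>

lemma countable_plateau:
  assumes rs: "set rs \<subseteq> unit_rats" "rs \<noteq> []"
    and a: "a \<le> val (wsub rs (False ## True ## constw False))" "a < 1/2"
    and b: "val (wsub rs (True ## constw False)) < b"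
  shows "countable (survivors a b)"
proof (rule countable_survivors_wsub[OF rs _ _ _ a b])
  fix x
  assume zero: "\<And>n. \<not> x !! n \<Longrightarrow> sle (sdrop n x) (False ## True ## constw False)"
    and one: "\<And>n. x !! n \<Longrightarrow> slt (True ## constw False) (sdrop n x)"
  have step: "\<not> x !! Suc n" if "\<not> x !! n" for n
  proof
    assume S: "x !! Suc n"
    have "sdrop n x = False ## True ## sdrop (Suc (Suc n)) x"
      using that S sdrop_unfold[of n x] sdrop_unfold[of "Suc n" x] by metis
    then have "sle (sdrop (Suc (Suc n)) x) (constw False)" using zero[OF that] by (simp add: sle_Cons)
    moreover have "slt (constw False) (sdrop (Suc (Suc n)) x)"
      using one[OF S] sdrop_unfold[of "Suc n" x] S by (metis slt_Cons)
    ultimately show False using not_sle_iff by blast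
  qed
  show "evper x"
  proof (cases "\<exists>n. \<not> x !! n")
    case True
    then obtain n where n: "\<not> x !! n" by blast
    have "\<not> x !! m" if "n \<le> m" for m
      using that by (induction m rule: dec_induct) (use n step in auto)
    then show ?thesis by (intro eventually_const_evper[of n x False]) simp
  next
    case False
    then show ?thesis by (intro eventually_const_evper[of 0 x True]) simp
  qed
qed simp_all

text \<open>Here 10 cannot occur, as the rest after it would exceed \<open>1^inf\<close>; so a 1 is
  followed by ones only.\<close>

lemma countable_endpoint:
  assumes rs: "set rs \<subseteq> unit_rats" "rs \<noteq> []"
    and a: "a \<le> val (wsub rs (False ## constw True))" "a < 1/2"
    and b: "val (wsub rs (True ## False ## constw True)) < b"
  shows "countable (survivors a b)"
proof (rule countable_survivors_wsub[OF rs _ _ _ a b])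
  fix x
  assume one: "\<And>n. x !! n \<Longrightarrow> slt (True ## False ## constw True) (sdrop n x)"
  have step: "x !! Suc n" if "x !! n" for n
  proof (rule ccontr)
    assume S: "\<not> x !! Suc n"
    have "sdrop n x = True ## False ## sdrop (Suc (Suc n)) x"
      using that S sdrop_unfold[of n x] sdrop_unfold[of "Suc n" x] by metis
    then have "slt (constw True) (sdrop (Suc (Suc n)) x)" using one[OF that] by (simp add: slt_Cons)
    then show False using constw_greatest not_sle_iff by blast
  qed
  show "evper x"
  proof (cases "\<exists>n. x !! n")
    case True
    then obtain n where n: "x !! n" by blast
    have "x !! m" if "n \<le> m" for m
      using that by (induction m rule: dec_induct) (use n step in auto)
    then show ?thesis by (intro eventually_const_evper[of n x True]) simp
  next
    case False
    then show ?thesis by (intro eventually_const_evper[of 0 x False]) simp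
  qed
qed simp_all

text \<open>By \<open>wsub_tails\<close> the image of all infinite words survives, and values
  separate its points because every image has infinitely many ones.\<close>

lemma uncountable_survivors_wsub:
  assumes rs: "set rs \<subseteq> unit_rats" "rs \<noteq> []" and a: "val (wsub rs (False ## constw True)) \<le> a"
  shows "uncountable (survivors a (val (wsub rs (True ## constw False))))"
proof
  let ?b = "val (wsub rs (True ## constw False))"
  assume c: "countable (survivors a ?b)"
  have inf: "\<exists>m\<ge>n. wsub rs x !! m" for n x
    using wsub_infinitely_many[OF rs, of n x True] by simp
  have "range (\<lambda>x. val (wsub rs x)) \<subseteq> survivors a ?b"
  proof
    fix v assume "v \<in> range (\<lambda>x. val (wsub rs x))"
    then obtain x where v: "v = val (wsub rs x)" by blast
    have "(doubling ^^ n) v \<notin> {a<..<?b}" for n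
    proof -
      have eq: "(doubling ^^ n) v = val (sdrop n (wsub rs x))"
        unfolding v using inf by (rule doubling_pow_val)
      have "val (sdrop n (wsub rs x)) \<le> a \<or> ?b \<le> val (sdrop n (wsub rs x))"
        using wsub_tails[OF rs(1), of x n] sle_val_le a by (meson order_trans)
      then show ?thesis unfolding eq by auto
    qed
    then show "v \<in> survivors a ?b" using val_nonneg val_le_1 by (auto simp: survivors_def v)
  qed
  then have "countable (range (\<lambda>x. val (wsub rs x)))" using c countable_subset by blast
  moreover have "inj (\<lambda>x. val (wsub rs x))"
  proof (rule injI, rule ccontr)
    fix x y assume eq: "val (wsub rs x) = val (wsub rs y)" and "x \<noteq> y"
    then have "slt (wsub rs x) (wsub rs y) \<or> slt (wsub rs y) (wsub rs x)"
      using slt_linear slt_wsub_iff[OF rs(1)] by blast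
    then show False using slt_val_less inf eq by force
  qed
  ultimately show False using countable_image_inj_on uncountable_bool_stream by blast
qed

section \<open>The function \<open>\<chi>\<close>\<close>

lemma chi_ge:
  assumes "a < b" "b < 1" "uncountable (survivors a b)" shows "b \<le> chi a"
  unfolding chi_def by (rule cSup_upper) (use assms in \<open>auto intro: bdd_aboveI[of _ 1]\<close>)

lemma chi_ge_wsub:
  assumes rs: "set rs \<subseteq> unit_rats" "rs \<noteq> []"
    and a: "val (wsub rs (False ## constw True)) \<le> a" "a < 1/2"
  shows "val (wsub rs (True ## constw False)) \<le> chi a"
proof (rule chi_ge)
  obtain x where x: "wsub rs (True ## constw False) = True ## x"
    using wsub_first[OF rs(1), of "True ## constw False"] by (cases "wsub rs (True ## constw False)") simp
  then have "1/2 \<le> val (wsub rs (True ## constw False))"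
    using val_nonneg[of x] by (simp add: val_Stream)
  then show "a < val (wsub rs (True ## constw False))" using a by simp
  obtain m where "\<not> wsub rs (True ## constw False) !! m"
    using wsub_infinitely_many[OF rs, of 0 _ False] by auto
  then show "val (wsub rs (True ## constw False)) < 1" by (rule val_less_1)
  show "uncountable (survivors a (val (wsub rs (True ## constw False))))"
    using rs a by (intro uncountable_survivors_wsub)
qed

lemma right_approx_val:
  assumes rs: "set rs \<subseteq> unit_rats" and \<gamma>: "0 \<le> \<gamma>" "\<gamma> < 1" and e: "0 < e"
  obtains r where "r \<in> unit_rats" "\<gamma> < of_rat r"
    "val (wsub rs (False ## True ## cu (of_rat r))) < val (wsub rs (False ## True ## cu \<gamma>)) + e"
proof -
  obtain k where k: "1 / 2 ^ k < e"
    using reals_power_lt_ex[of e 2] e by (auto simp: power_one_over field_simps)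
  obtain b where b: "b \<le> 1" "\<gamma> < b"
    "\<And>x. \<gamma> < x \<Longrightarrow> x < b \<Longrightarrow> stake k (cl x) = stake k (cu \<gamma>) \<and> stake k (cu x) = stake k (cu \<gamma>)"
    using cu_right_approx[OF \<gamma>(2)] by blast
  obtain r where r: "r \<in> unit_rats" "\<gamma> < of_rat r" "of_rat r < b"
    using unit_rat_between[OF \<gamma>(1) b(2,1)] .
  have "\<bar>val (wsub rs (False ## True ## cu (of_rat r))) - val (wsub rs (False ## True ## cu \<gamma>))\<bar> \<le> 1 / 2 ^ k"
    using b(3)[OF r(2,3)] by (intro wsub_close[OF rs]) blast
  then show ?thesis using that[OF r(1,2)] k by linarith
qed

lemma left_approx_val:
  assumes rs: "set rs \<subseteq> unit_rats" and \<gamma>: "0 < \<gamma>" "\<gamma> \<le> 1" and e: "0 < e"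
  obtains r where "r \<in> unit_rats" "of_rat r < \<gamma>"
    "val (wsub rs (c ## d ## cl \<gamma>)) - e < val (wsub rs (c ## d ## cl (of_rat r)))"
proof -
  obtain k where k: "1 / 2 ^ k < e"
    using reals_power_lt_ex[of e 2] e by (auto simp: power_one_over field_simps)
  obtain b where b: "0 \<le> b" "b < \<gamma>"
    "\<And>x. b < x \<Longrightarrow> x < \<gamma> \<Longrightarrow> stake k (cl x) = stake k (cl \<gamma>) \<and> stake k (cu x) = stake k (cl \<gamma>)"
    using cl_left_approx[OF \<gamma>(1)] by blast
  obtain r where r: "r \<in> unit_rats" "b < of_rat r" "of_rat r < \<gamma>"
    using unit_rat_between[OF b(1,2) \<gamma>(2)] .
  have "\<bar>val (wsub rs (c ## d ## cl (of_rat r))) - val (wsub rs (c ## d ## cl \<gamma>))\<bar> \<le> 1 / 2 ^ k"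
    using b(3)[OF r(2,3)] by (intro wsub_close[OF rs]) blast
  then show ?thesis using that[OF r(1,3)] k by linarith
qed

lemma chi_le:
  assumes a: "1/4 < a" "a < 1/2" and c: "\<And>b. \<beta> < b \<Longrightarrow> countable (survivors a b)"
  shows "chi a \<le> \<beta>"
  unfolding chi_def
proof (rule cSup_least)
  \<comment> \<open>The supremum is taken over a nonempty set: a slope close to 0 has its right end
    \<open>01 cu r\<close> close to 1/4, hence below \<open>a\<close>, and
    \<open>uncountable_survivors_wsub\<close> provides a member.\<close>
  obtain r where r: "r \<in> unit_rats"
    and "val (wsub [] (False ## True ## cu (of_rat r))) < val (wsub [] (False ## True ## cu 0)) + (a - 1/4)"
    using right_approx_val[of "[]" 0 "a - 1/4"] a by auto
  then have "val (wsub [r] (False ## constw True)) < a"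
    using wsub_single(2)[OF r] by (simp add: cu_0 val_Stream)
  moreover have "1/2 \<le> val (wsub [r] (True ## constw False))"
    using wsub_single(3)[OF r] val_nonneg by (simp add: val_Stream)
  moreover have "val (wsub [r] (True ## constw False)) < 1"
  proof -
    have "\<exists>m\<ge>0. wsub [r] (True ## constw False) !! m = False"
      using r by (intro wsub_infinitely_many) auto
    then show ?thesis using val_less_1 by blast
  qed
  moreover have "uncountable (survivors a (val (wsub [r] (True ## constw False))))"
    using r calculation(1) by (intro uncountable_survivors_wsub) auto
  ultimately show "{b. a < b \<and> b < 1 \<and> uncountable (survivors a b)} \<noteq> {}"
    using a by fastforce
next
  fix b assume "b \<in> {b. a < b \<and> b < 1 \<and> uncountable (survivors a b)}"
  then show "b \<le> \<beta>" using c[of b] by force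
qed

text \<open>Stated for every \<open>a\<close> up to the right end of the plateau, so that it also
  acts as a monotonicity bound.\<close>

lemma chi_le_plateau:
  assumes rs: "set rs \<subseteq> unit_rats" "rs \<noteq> []"
    and a: "1/4 < a" "a < 1/2" "a \<le> val (wsub rs (False ## True ## constw False))"
  shows "chi a \<le> val (wsub rs (True ## constw False))"
  using countable_plateau[OF rs a(3,2)] by (intro chi_le a)

text \<open>For \<open>rs\<close> itself, \<open>chi_ge_wsub\<close> starts only at
  \<open>s t^inf\<close>. Slightly smaller last rationals \<open>r'\<close> have their right ends
  \<open>01 cu r'\<close> at most at \<open>01 cl r\<close>, the left end of this plateau, and the
  lower bounds \<open>10 cl r'\<close> tend to \<open>10 cl r\<close>.\<close>

lemma chi_ge_plateau:
  assumes rs: "set rs \<subseteq> unit_rats" "rs \<noteq> []"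
    and a: "val (wsub rs (constw False)) \<le> a" "a < 1/2"
  shows "val (wsub rs (True ## constw False)) \<le> chi a"
proof -
  obtain rs' r where rs': "rs = rs' @ [r]" using rs(2) rev_exhaust by blast
  have u: "set rs' \<subseteq> unit_rats" "r \<in> unit_rats" using rs rs' by auto
  have r: "0 < real_of_rat r" "real_of_rat r < 1" using u(2) by auto
  note snoc = wsub_snoc[OF u(1)]
  show ?thesis
  proof (rule field_le_epsilon)
    fix e :: real assume "0 < e"
    then obtain r' where r': "r' \<in> unit_rats" "real_of_rat r' < of_rat r"
      "val (wsub rs' (True ## False ## cl (of_rat r))) - e < val (wsub rs' (True ## False ## cl (of_rat r')))"
      using left_approx_val[OF u(1) r(1), of e True False] r(2) by auto
    have r'_pos: "0 \<le> real_of_rat r'" using r'(1) by auto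
    have "val (wsub rs' (False ## True ## cu (of_rat r'))) \<le> val (wsub rs' (False ## True ## cl (of_rat r)))"
      using sle_cu_cl[OF r'_pos r'(2)] r(2) by (intro wsub_val_mono[OF u(1)]) (simp add: sle_Cons)
    then have "val (wsub rs' (True ## False ## cl (of_rat r'))) \<le> chi a"
      using chi_ge_wsub[of "rs' @ [r']" a] a u r'(1) by (simp add: snoc rs')
    then show "val (wsub rs (True ## constw False)) \<le> chi a + e"
      using r'(3) by (simp add: snoc[OF u(2)] rs')
  qed
qed

lemma chi_plateau:
  assumes rs: "set rs \<subseteq> unit_rats" "rs \<noteq> []"
    and a: "val (wsub rs (constw False)) \<le> a" "a \<le> val (wsub rs (False ## True ## constw False))"
  shows "chi a = val (wsub rs (True ## constw False))"
proof -
  have "val (wsub rs (False ## True ## constw False)) \<le> val (wsub rs (False ## constw True))"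
    by (intro wsub_val_mono[OF rs(1)]) (simp add: sle_Cons constw_greatest)
  then have "1/4 < a" "a < 1/2" using wsub_range[OF rs] a by linarith+
  then show ?thesis
    using chi_le_plateau[OF rs] chi_ge_plateau[OF rs] a by (simp add: order_antisym)
qed

text \<open>A last rational slightly below \<open>r\<close> still has its left end above
  \<open>a\<close>, and the value of its plateau is smaller since \<open>cl\<close> increases
  strictly with the slope.\<close>

lemma chi_less_left:
  assumes rs: "set rs \<subseteq> unit_rats" "rs \<noteq> []"
    and a: "1/4 < a" "a < val (wsub rs (constw False))"
  shows "chi a < val (wsub rs (True ## constw False))"
proof -
  obtain rs' r where rs': "rs = rs' @ [r]" using rs(2) rev_exhaust by blast
  have u: "set rs' \<subseteq> unit_rats" "r \<in> unit_rats" using rs rs' by auto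
  have r: "0 < real_of_rat r" "real_of_rat r < 1" using u(2) by auto
  note snoc = wsub_snoc[OF u(1)]
  define e where "e = val (wsub rs (constw False)) - a"
  have "0 < e" using a by (simp add: e_def)
  then obtain r' where r': "r' \<in> unit_rats" "real_of_rat r' < of_rat r"
    "val (wsub rs' (False ## True ## cl (of_rat r))) - e < val (wsub rs' (False ## True ## cl (of_rat r')))"
    using left_approx_val[OF u(1) r(1), of e False True] r(2) by auto
  have u': "set (rs' @ [r']) \<subseteq> unit_rats" using u r' by auto
  have lt: "a < val (wsub (rs' @ [r']) (constw False))"
    using r'(3) by (simp add: snoc[OF r'(1)] snoc[OF u(2)] e_def rs')
  also have "\<dots> \<le> val (wsub (rs' @ [r']) (False ## True ## constw False))"
    by (intro wsub_val_mono[OF u'] constw_least)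
  finally have le: "a \<le> val (wsub (rs' @ [r']) (False ## True ## constw False))" by simp
  have "val (wsub (rs' @ [r']) (constw False)) \<le> val (wsub (rs' @ [r']) (False ## constw True))"
    by (intro wsub_val_mono[OF u'] constw_least)
  then have "a < 1/2" using wsub_range(2)[OF u'] lt by simp
  then have "chi a \<le> val (wsub (rs' @ [r']) (True ## constw False))"
    using chi_le_plateau[OF u' _ a(1) _ le] by simp
  also have "\<dots> = val (wsub rs' (True ## False ## cl (of_rat r')))" by (simp add: snoc[OF r'(1)])
  also have "\<dots> < val (wsub rs (True ## constw False))"
  proof (rule slt_val_less)
    show "slt (wsub rs' (True ## False ## cl (of_rat r'))) (wsub rs (True ## constw False))"
      using slt_cl[of "of_rat r'" "of_rat r"] r r'
      by (simp add: snoc[OF u(2)] rs' slt_wsub_iff[OF u(1)] slt_Cons)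
    show "(\<forall>n. \<exists>m\<ge>n. \<not> wsub rs' (True ## False ## cl (of_rat r')) !! m) \<or>
        (\<forall>n. \<exists>m\<ge>n. wsub rs (True ## constw False) !! m)"
      using wsub_infinitely_many[OF rs, of _ _ True] by simp
  qed
  finally show ?thesis .
qed

text \<open>One level deeper, a small slope \<open>r\<close> has its right end
  \<open>01 cu r\<close> so close to \<open>010^inf\<close> that it stays below \<open>a\<close>;
  its lower bound \<open>10 cl r\<close> exceeds \<open>10^inf\<close> because \<open>cl r\<close>
  contains a 1.\<close>

lemma chi_greater_right:
  assumes rs: "set rs \<subseteq> unit_rats" "rs \<noteq> []"
    and a: "val (wsub rs (False ## True ## constw False)) < a" "a < 1/2"
  shows "val (wsub rs (True ## constw False)) < chi a"
proof -
  define e where "e = a - val (wsub rs (False ## True ## constw False))"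
  have "0 < e" using a by (simp add: e_def)
  then obtain r where r: "r \<in> unit_rats"
    "val (wsub rs (False ## True ## cu (of_rat r))) < val (wsub rs (False ## True ## cu 0)) + e"
    using right_approx_val[OF rs(1), of 0 e] by auto
  have u: "set (rs @ [r]) \<subseteq> unit_rats" "rs @ [r] \<noteq> []" using rs r by auto
  note snoc = wsub_snoc[OF rs(1) r(1)]
  have "slt (constw False) (cl (of_rat r))"
  proof -
    have "cl (of_rat r) \<noteq> constw False"
    proof
      assume *: "cl (of_rat r) = constw False"
      have "\<exists>m\<ge>2. wsub [r] (constw False) !! m = True"
        using r by (intro wsub_infinitely_many) auto
      then obtain m where "m \<ge> 2" "(False ## True ## constw False) !! m"
        using wsub_single(1)[OF r(1)] * by auto
      then show False by (cases m; cases "m - 1") auto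
    qed
    then show ?thesis using constw_least[of "cl (of_rat r)"] unfolding sle_def by metis
  qed
  then have "slt (wsub rs (True ## constw False)) (wsub (rs @ [r]) (True ## constw False))"
    using constw_unfold[of False] by (metis snoc(3) slt_wsub_iff[OF rs(1)] slt_Cons)
  then have "val (wsub rs (True ## constw False)) < val (wsub (rs @ [r]) (True ## constw False))"
    using wsub_infinitely_many[OF u, of _ _ True] by (intro slt_val_less) simp_all
  also have "\<dots> \<le> chi a"
    using r(2) a by (intro chi_ge_wsub[OF u]) (simp_all add: snoc e_def cu_0)
  finally show ?thesis .
qed

section \<open>The gaps between plateaus\<close>

lemma length_sw: "set rs \<subseteq> unit_rats \<Longrightarrow> length (sw rs) = Qprod rs"
proof (induction rs)
  case Nil
  then show ?case by (simp add: Qprod_def)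
next
  case (Cons r rs)
  then show ?case using sw_append[of "[r]" rs] length_sb[OF blk_omega, of r] length_omega(1)[of r]
    by (simp add: Qprod_def)
qed

text \<open>Exchanging the first two blocks \<open>s t\<close> for \<open>t s\<close> moves the
  value by an amount independent of what follows. This is the translation in (ii) and (iii), equal
  to 1/4 for the empty list.\<close>

lemma val_wsub_swap:
  assumes "set rs \<subseteq> unit_rats"
  shows "val (wsub rs (True ## False ## x)) = val (wsub rs (False ## True ## x))
     + (1 - 1 / 2 ^ Qprod rs) * (fval (tw rs) - fval (sw rs))"
proof -
  have "length (sw rs) = Qprod rs" "length (tw rs) = Qprod rs"
    using length_sw[OF assms] blkD(1)[OF blk_sw[OF assms]] by auto
  then show ?thesis by (simp add: wsub_Stream[OF assms] val_shift field_simps)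
qed

lemma Delta_wsub:
  assumes "set rs \<subseteq> unit_rats" "r \<in> unit_rats"
  shows "Delta (rs @ [r]) = {val (wsub rs (False ## True ## cl (of_rat r))) ..
     val (wsub rs (False ## True ## cu (of_rat r)))}"
proof -
  have "set (rs @ [r]) \<subseteq> unit_rats" using assms by auto
  then show ?thesis unfolding Delta_def wsub_snoc[OF assms, symmetric] by (simp only: wsub_words)
qed

text \<open>The slope \<open>\<gamma>\<close> is where \<open>a\<close> separates the intervals \<open>\<Delta>(r\<^sub>1,\<dots>,r\<^sub>n,r)\<close>. If \<open>0 < \<gamma> < 1\<close>, then it must
  be irrational; at the right end point \<open>\<gamma> = 1\<close> the function \<open>\<chi>\<close> jumps, so the upper bound is
  not obtained from plateaus further to the right.\<close>

lemma chi_gap: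
  assumes rs: "set rs \<subseteq> unit_rats" and a: "1/4 < a" "a < 1/2"
    and a_range: "val (wsub rs (False ## True ## constw False)) \<le> a"
      "a \<le> val (wsub rs (False ## constw True))"
    and gap: "\<And>r. r \<in> unit_rats \<Longrightarrow> a \<notin> Delta (rs @ [r])"
  shows "chi a = a + (1 - 1 / 2 ^ Qprod rs) * (fval (tw rs) - fval (sw rs))"
proof -
  define D where "D = (1 - 1 / 2 ^ Qprod rs) * (fval (tw rs) - fval (sw rs))"
  define F where "F x = val (wsub rs (False ## True ## x))" for x
  have swap: "val (wsub rs (True ## False ## x)) = F x + D" for x
    unfolding F_def D_def by (rule val_wsub_swap[OF rs])
  have F_close: "\<bar>F x - F y\<bar> \<le> 1 / 2 ^ k" if "stake k x = stake k y" for k x y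
    unfolding F_def using rs that by (rule wsub_close)
  have plateau_ge: "F (cl (of_rat r)) + D \<le> chi a" if "r \<in> unit_rats" "F (cl (of_rat r)) \<le> a" for r
    using chi_ge_plateau[of "rs @ [r]" a] that a rs by (simp add: wsub_snoc swap F_def)
  have plateau_le: "chi a \<le> F (cl (of_rat r)) + D" if r: "r \<in> unit_rats" "a < F (cl (of_rat r))" for r
  proof -
    have u: "set (rs @ [r]) \<subseteq> unit_rats" "rs @ [r] \<noteq> []" using rs r by auto
    have "F (cl (of_rat r)) = val (wsub (rs @ [r]) (constw False))"
      using wsub_snoc[OF rs r(1)] by (simp add: F_def)
    also have "\<dots> \<le> val (wsub (rs @ [r]) (False ## True ## constw False))"
      by (intro wsub_val_mono[OF u(1)] constw_least)
    finally have "chi a \<le> val (wsub (rs @ [r]) (True ## constw False))"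
      using r(2) by (intro chi_le_plateau[OF u a]) simp
    then show ?thesis using wsub_snoc[OF rs r(1)] swap by simp
  qed
  define R where "R = {real_of_rat r | r. r \<in> unit_rats \<and> F (cl (of_rat r)) \<le> a}"
  have R01: "0 < x" "x < 1" if "x \<in> R" for x using that by (auto simp: R_def)
  have bdd: "bdd_above R" using R01(2) by (intro bdd_aboveI[of _ 1]) (simp add: less_imp_le)
  \<comment> \<open>The default 0 covers the case that all intervals lie to the right of
    \<open>a\<close>.\<close>
  define \<gamma> where "\<gamma> = (if R = {} then 0 else Sup R)"
  have R_le: "x \<le> \<gamma>" if "x \<in> R" for x
    using that cSup_upper[OF that bdd] by (auto simp: \<gamma>_def)
  have \<gamma>01: "0 \<le> \<gamma>" "\<gamma> \<le> 1"
  proof -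
    show "\<gamma> \<le> 1" using cSup_least[of R 1] R01(2) by (auto simp: \<gamma>_def less_imp_le)
    show "0 \<le> \<gamma>"
    proof (cases "R = {}")
      case False
      then obtain x where "x \<in> R" by blast
      then show ?thesis using R_le[of x] R01[of x] by simp
    qed (simp add: \<gamma>_def)
  qed
  have eps: "x \<le> y" if "\<And>k. x \<le> y + 1 / 2 ^ k" for x y :: real
  proof -
    have "(\<lambda>k. y + 1 / 2 ^ k) \<longlonglongrightarrow> y + 0"
      using LIMSEQ_power_zero[of "1/2::real"] by (intro tendsto_add tendsto_const) (simp add: power_divide)
    then have "x \<le> y + 0" by (rule LIMSEQ_le_const) (use that in auto)
    then show ?thesis by simp
  qed
  \<comment> \<open>Elements of \<open>R\<close> close to \<gamma> share long prefixes with
    \<open>cl \<gamma>\<close>, so their bounds pass to the limit; \<gamma> itself may belong to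
    \<open>R\<close>.\<close>
  have low: "F (cl \<gamma>) \<le> a" "F (cl \<gamma>) + D \<le> chi a" if "0 < \<gamma>"
  proof -
    have ne: "R \<noteq> {}" using that by (auto simp: \<gamma>_def)
    have "F (cl \<gamma>) \<le> a + 1 / 2 ^ k \<and> F (cl \<gamma>) + D \<le> chi a + 1 / 2 ^ k" for k
    proof -
      obtain b where b: "b < \<gamma>"
        "\<And>x. b < x \<Longrightarrow> x < \<gamma> \<Longrightarrow> stake k (cl x) = stake k (cl \<gamma>) \<and> stake k (cu x) = stake k (cl \<gamma>)"
        using cl_left_approx[OF \<open>0 < \<gamma>\<close>] by metis
      obtain x where x: "x \<in> R" "b < x"
        using b(1) less_cSup_iff[OF ne bdd] ne by (auto simp: \<gamma>_def)
      obtain r where r: "x = of_rat r" "r \<in> unit_rats" "F (cl (of_rat r)) \<le> a"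
        using x(1) by (auto simp: R_def)
      have "stake k (cl \<gamma>) = stake k (cl x)"
        using R_le[OF x(1)] b(2)[OF x(2)] by (cases "x = \<gamma>") auto
      then have "F (cl \<gamma>) \<le> F (cl (of_rat r)) + 1 / 2 ^ k" using F_close r(1) by fastforce
      then show ?thesis using r(3) plateau_ge[OF r(2,3)] by linarith
    qed
    then show "F (cl \<gamma>) \<le> a" "F (cl \<gamma>) + D \<le> chi a" using eps by blast+
  qed
  \<comment> \<open>Rationals above \<gamma> are outside \<open>R\<close>, and their words converge
    to \<open>cu \<gamma>\<close>.\<close>
  have upp: "a \<le> F (cu \<gamma>)" "chi a \<le> F (cu \<gamma>) + D" if "\<gamma> < 1"
  proof -
    have "a \<le> F (cu \<gamma>) + 1 / 2 ^ k \<and> chi a \<le> F (cu \<gamma>) + D + 1 / 2 ^ k" for k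
    proof -
      obtain b where b: "b \<le> 1" "\<gamma> < b"
        "\<And>x. \<gamma> < x \<Longrightarrow> x < b \<Longrightarrow> stake k (cl x) = stake k (cu \<gamma>) \<and> stake k (cu x) = stake k (cu \<gamma>)"
        using cu_right_approx[OF \<open>\<gamma> < 1\<close>] by metis
      obtain r where r: "r \<in> unit_rats" "\<gamma> < of_rat r" "of_rat r < b"
        using unit_rat_between[OF \<gamma>01(1) b(2,1)] .
      have "real_of_rat r \<notin> R" using R_le r(2) by force
      then have ar: "a < F (cl (of_rat r))" using r(1) unfolding R_def by force
      have "\<bar>F (cl (of_rat r)) - F (cu \<gamma>)\<bar> \<le> 1 / 2 ^ k" using b(3)[OF r(2,3)] by (intro F_close) blast
      then show ?thesis using ar plateau_le[OF r(1) ar] by linarith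
    qed
    then show "a \<le> F (cu \<gamma>)" "chi a \<le> F (cu \<gamma>) + D" using eps by blast+
  qed
  have "chi a = a + D"
  proof -
    consider "\<gamma> = 0" | "\<gamma> = 1" | "0 < \<gamma>" "\<gamma> < 1" "\<gamma> \<in> \<rat>" | "0 < \<gamma>" "\<gamma> < 1" "\<gamma> \<notin> \<rat>"
      using \<gamma>01 by linarith
    then show ?thesis
    proof cases
      \<comment> \<open>Now \<open>a\<close> is the left end of the range, where the plateau of
        \<open>rs\<close> itself gives the lower bound.\<close>
      case 1
      have ne: "rs \<noteq> []"
      proof
        assume "rs = []"
        then have "F (cu \<gamma>) = 1/4" using 1 by (simp add: F_def cu_0 val_Stream)
        then show False using upp(1) 1 a by simp
      qed
      have "a = F (constw False)" using upp(1) a_range(1) 1 by (simp add: F_def cu_0)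
      moreover have "chi a \<le> F (constw False) + D" using upp(2) 1 by (simp add: cu_0)
      moreover have "F (constw False) + D \<le> chi a"
      proof -
        have "val (wsub rs (constw False)) \<le> val (wsub rs (False ## True ## constw False))"
          by (intro wsub_val_mono[OF rs] constw_least)
        then have "val (wsub rs (True ## constw False)) \<le> chi a"
          using a_range(1) a by (intro chi_ge_plateau[OF rs ne]) simp_all
        then show ?thesis using swap[of "constw False"] constw_unfold[of False] by simp
      qed
      ultimately show ?thesis by simp
    next
      case 2
      have eq: "F (constw True) = val (wsub rs (False ## constw True))"
        using constw_unfold[of True] by (simp add: F_def)
      have aeq: "a = F (constw True)" and le: "F (constw True) + D \<le> chi a"
        using low a_range(2) 2 eq by (simp_all add: cl_1)
      have "rs \<noteq> []"
      proof
        assume "rs = []"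
        then show False using aeq a by (simp add: F_def val_Stream)
      qed
      then have "chi a \<le> val (wsub rs (True ## False ## constw True))"
        using countable_endpoint[OF rs _ a_range(2) a(2)] by (intro chi_le a)
      then show ?thesis using aeq le swap by simp
    next
      case 3
      then obtain r where r: "\<gamma> = of_rat r" by (auto elim: Rats_cases)
      then have "r \<in> unit_rats" using 3 by simp
      then have "a \<in> Delta (rs @ [r])"
        using low(1) upp(1) 3 r by (simp add: Delta_wsub[OF rs] F_def)
      then show ?thesis using gap \<open>r \<in> unit_rats\<close> by blast
    next
      \<comment> \<open>For an irrational slope the bounds from both sides coincide.\<close>
      case 4
      then show ?thesis using low upp cl_eq_cu[of \<gamma>] by simp
    qed
  qed
  then show ?thesis by (simp add: D_def)
qed

section \<open>Infinite sequences of rationals\<close>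

lemma initial_Suc: "initial r (Suc n) = initial r n @ [r n]"
  by (simp add: initial_def)

lemma set_initial: "range r \<subseteq> unit_rats \<Longrightarrow> set (initial r n) \<subseteq> unit_rats"
  by (auto simp: initial_def)

lemma omega_Cons:
  assumes "r \<in> unit_rats"
  obtains u v where "omega_minus r = False # u" "omega_plus r = True # v"
  using blk_omega[OF assms] that by (cases "omega_minus r"; cases "omega_plus r") (auto simp: blk_def)

text \<open>The block for 0 starts with 0 and that for 1 with 1, so appending a rational extends
  both words to the right.\<close>

lemma initial_prefix:
  assumes "range r \<subseteq> unit_rats" "n \<le> m"
  shows "\<exists>u v. sw (initial r m) = sw (initial r n) @ u \<and> tw (initial r m) = tw (initial r n) @ v"
  using assms(2)
proof (induction m rule: dec_induct)
  case (step m)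
  have "r m \<in> unit_rats" using assms(1) by blast
  then obtain u v where "omega_minus (r m) = False # u" "omega_plus (r m) = True # v"
    by (rule omega_Cons)
  then show ?case using step.IH by (auto simp: initial_Suc sw_append tw_append)
qed auto

lemma initial_length:
  assumes "range r \<subseteq> unit_rats"
  shows "n < length (sw (initial r n))" "length (tw (initial r n)) = length (sw (initial r n))"
proof -
  show "n < length (sw (initial r n))"
  proof (induction n)
    case 0
    then show ?case by (simp add: initial_def)
  next
    case (Suc n)
    have rn: "r n \<in> unit_rats" using assms by blast
    have "length (sw (initial r (Suc n))) = rat_den (r n) * length (sw (initial r n))"
      using length_sb[OF blk_sw[OF set_initial[OF assms]]] length_omega(1)[OF rn]
      by (simp add: initial_Suc sw_append)
    moreover have "2 * length (sw (initial r n)) \<le> rat_den (r n) * length (sw (initial r n))"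
      using length_omega(2)[OF rn] by simp
    ultimately show ?case using Suc by linarith
  qed
  show "length (tw (initial r n)) = length (sw (initial r n))"
    using blkD(1)[OF blk_sw[OF set_initial[OF assms]]] .
qed

lemma stake_word_lim:
  assumes W: "\<And>m. n \<le> m \<Longrightarrow> \<exists>u. W m = W n @ u"
  shows "stake (length (W n)) (word_lim W) = W n"
proof (rule nth_equalityI)
  fix k assume "k < length (stake (length (W n)) (word_lim W))"
  then have k: "k < length (W n)" by simp
  have "W m ! k = W n ! k" if "n \<le> m" for m
    using W[OF that] k by (auto simp: nth_append)
  then have "eventually (\<lambda>m. W m ! k = W n ! k) sequentially"
    unfolding eventually_sequentially by blast
  then have "(\<lambda>m. W m ! k) \<longlonglongrightarrow> W n ! k" by (rule tendsto_eventually)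
  then have "lim (\<lambda>m. W m ! k) = W n ! k" by (rule limI)
  then show "stake (length (W n)) (word_lim W) ! k = W n ! k"
    using k by (simp add: word_lim_def)
qed simp

lemma squeeze_shift:
  assumes "val (u @- x) \<le> a" "a \<le> val (u @- y)" "stake (length u) z = u"
  shows "\<bar>a - val z\<bar> \<le> 1 / 2 ^ length u"
proof -
  have "z = u @- sdrop (length u) z" using assms(3) by (metis stake_sdrop)
  then have z: "val z = fval u + val (sdrop (length u) z) / 2 ^ length u" by (metis val_shift)
  have b: "0 \<le> val w / 2 ^ length u" "val w / 2 ^ length u \<le> 1 / 2 ^ length u" for w
    using val_nonneg[of w] val_le_1[of w] by (simp_all add: divide_right_mono)
  show ?thesis using assms(1,2) z b[of x] b[of y] b[of "sdrop (length u) z"]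
    unfolding val_shift by linarith
qed

lemma eq_by_approx:
  fixes a b :: real
  assumes "\<And>n. 1 \<le> n \<Longrightarrow> \<exists>k>n. \<bar>a - b\<bar> \<le> 1 / 2 ^ k" shows "a = b"
proof -
  have "(\<lambda>n. 1 / 2 ^ n :: real) \<longlonglongrightarrow> 0"
    using LIMSEQ_power_zero[of "1/2::real"] by (simp add: power_divide)
  moreover have "\<bar>a - b\<bar> \<le> 1 / 2 ^ n" if n: "1 \<le> n" for n
  proof -
    obtain k where "k > n" "\<bar>a - b\<bar> \<le> 1 / 2 ^ k" using assms[OF n] by blast
    moreover have "1 / 2 ^ k \<le> (1 / 2 ^ n :: real)"
      using \<open>k > n\<close> by (intro divide_left_mono power_increasing) auto
    ultimately show ?thesis by linarith
  qed
  ultimately have "\<bar>a - b\<bar> \<le> 0" by (intro LIMSEQ_le_const[of _ 0]) auto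
  then show ?thesis by simp
qed

text \<open>The point \<open>a\<close> lies between two words with prefix \<open>s_n\<close>, and
  \<chi>(a) between \<open>t_n s_n^inf\<close> and \<open>t_n s_n t_n^inf\<close>, both with prefix
  \<open>t_n\<close>. The lengths of these prefixes are unbounded.\<close>

lemma chi_limit:
  assumes r: "range r \<subseteq> unit_rats" and a: "\<And>n. 1 \<le> n \<Longrightarrow> a \<in> Delta_tilde (initial r n)"
  shows "a = val (s_lim r)" "chi a = val (t_lim r)"
proof -
  have *: "\<bar>a - val (s_lim r)\<bar> \<le> 1 / 2 ^ length (sw (initial r n)) \<and>
      \<bar>chi a - val (t_lim r)\<bar> \<le> 1 / 2 ^ length (tw (initial r n))" if n: "1 \<le> n" for n
  proof -
    define rs where "rs = initial r n"
    have rs: "set rs \<subseteq> unit_rats" "rs \<noteq> []" using set_initial[OF r] n by (auto simp: rs_def initial_def)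
    note words = wsub_words[OF rs(1)]
    have a1: "val (sw rs @- tw rs @- cycle (sw rs)) \<le> a" "a \<le> val (sw rs @- cycle (tw rs))"
      using a[OF n] by (auto simp: Delta_tilde_def rs_def)
    have "val (wsub rs (constw False)) \<le> val (wsub rs (False ## True ## constw False))"
      by (intro wsub_val_mono[OF rs(1)] constw_least)
    then have a2: "val (wsub rs (constw False)) \<le> a" "a \<le> val (wsub rs (False ## constw True))"
      using a1 unfolding words by linarith+
    then have a3: "1/4 < a" "a < 1/2" using wsub_range[OF rs] by linarith+
    have "val (tw rs @- cycle (sw rs)) \<le> chi a"
      using chi_ge_plateau[OF rs a2(1) a3(2)] unfolding words .
    moreover have "chi a \<le> val (wsub rs (True ## False ## constw True))"
      using countable_endpoint[OF rs a2(2) a3(2)] by (intro chi_le a3)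
    then have "chi a \<le> val (tw rs @- sw rs @- cycle (tw rs))" unfolding words .
    moreover have "stake (length (sw rs)) (s_lim r) = sw rs"
      unfolding s_lim_def rs_def using initial_prefix[OF r, of n] by (intro stake_word_lim) blast
    moreover have "stake (length (tw rs)) (t_lim r) = tw rs"
      unfolding t_lim_def rs_def using initial_prefix[OF r, of n] by (intro stake_word_lim) blast
    ultimately show ?thesis
      unfolding rs_def[symmetric] using squeeze_shift[OF a1] squeeze_shift[of "tw rs"] by simp
  qed
  show "a = val (s_lim r)"
  proof (rule eq_by_approx)
    fix n :: nat assume "1 \<le> n"
    from *[OF this] initial_length(1)[OF r]
    show "\<exists>k>n. \<bar>a - val (s_lim r)\<bar> \<le> 1 / 2 ^ k" by blast
  qed
  show "chi a = val (t_lim r)"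
  proof (rule eq_by_approx)
    fix n :: nat assume "1 \<le> n"
    from *[OF this] initial_length[OF r, of n]
    show "\<exists>k>n. \<bar>chi a - val (t_lim r)\<bar> \<le> 1 / 2 ^ k" by metis
  qed
qed

section \<open>Exhaustiveness of the four categories\<close>

text \<open>Outside (ii) and (iii) the point lies in some interval \<open>Delta\<close> of the next
  level, and outside (i) even in its part \<open>Delta_tilde\<close>, so the descent never
  stops.\<close>

lemma category_exhaustive:
  assumes a: "1/4 < a" "a < 1/2"
    and i: "\<And>rs. \<lbrakk>rs \<noteq> []; set rs \<subseteq> unit_rats\<rbrakk> \<Longrightarrow>
      a \<notin> {val (cycle (sw rs)) .. val (sw rs @- tw rs @- cycle (sw rs))}"
    and ii: "a \<notin> S_base"
    and iii: "\<And>rs. \<lbrakk>rs \<noteq> []; set rs \<subseteq> unit_rats\<rbrakk> \<Longrightarrow> a \<notin> S_level rs"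
  shows "\<exists>r. range r \<subseteq> unit_rats \<and> (\<forall>n\<ge>1. a \<in> Delta_tilde (initial r n))"
proof -
  have tilde: "a \<in> Delta_tilde rs" if "a \<in> Delta rs" "rs \<noteq> []" "set rs \<subseteq> unit_rats" for rs
    using i[OF that(2,3)] that(1) by (auto simp: Delta_def Delta_tilde_def)
  have step: "\<exists>r\<in>unit_rats. a \<in> Delta (rs @ [r])" if "rs = [] \<or> a \<in> Delta_tilde rs" "set rs \<subseteq> unit_rats" for rs
  proof (cases "rs = []")
    case True
    then show ?thesis using a ii by (auto simp: S_base_def)
  next
    case False
    then show ?thesis using that iii[OF False that(2)] by (auto simp: S_level_def)
  qed
  define P where "P rs = (set rs \<subseteq> unit_rats \<and> (rs = [] \<or> a \<in> Delta_tilde rs))" for rs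
  have "\<exists>r. P (rs @ [r])" if rs: "P rs" for rs
  proof -
    obtain r where r: "r \<in> unit_rats" "a \<in> Delta (rs @ [r])"
      using step[of rs] rs unfolding P_def by blast
    have "set (rs @ [r]) \<subseteq> unit_rats" using rs r by (auto simp: P_def)
    then show ?thesis using tilde[OF r(2)] unfolding P_def by blast
  qed
  \<comment> \<open>The next rational is chosen as a function of the list so far; recursion then
    yields the infinite sequence.\<close>
  then obtain g where g: "\<And>rs. P rs \<Longrightarrow> P (rs @ [g rs])" by metis
  define s where "s = rec_nat [] (\<lambda>_ rs. rs @ [g rs])"
  define r where "r n = g (s n)" for n
  have s: "s 0 = []" "s (Suc n) = s n @ [r n]" for n by (simp_all add: s_def r_def)
  have P: "P (s n)" for n
    by (induction n) (use g in \<open>auto simp: s P_def[of "[]"] r_def\<close>)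
  have init: "initial r n = s n" for n
    by (induction n) (simp_all add: s initial_Suc, simp add: initial_def)
  have "r n \<in> unit_rats" for n using P[of "Suc n"] by (simp add: P_def s)
  moreover have "a \<in> Delta_tilde (initial r n)" if "n \<ge> 1" for n
    using P[of n] that by (cases n) (auto simp: P_def init s)
  ultimately show ?thesis by blast
qed

section \<open>Collecting the values of \<chi> in all categories\<close>

theorem theorem2p13:
  shows
    "(\<forall>a::real. 1/4 < a \<and> a < 1/2 \<longrightarrow>
        (\<exists>n\<ge>1. \<exists>rs. length rs = n \<and> set rs \<subseteq> unit_rats \<and>
           a \<in> {val (cycle (sw rs)) .. val (sw rs @- tw rs @- cycle (sw rs))})
      \<or> a \<in> S_base
      \<or> (\<exists>n\<ge>2. \<exists>rs. length rs = n - 1 \<and> set rs \<subseteq> unit_rats \<and> a \<in> S_level rs)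
      \<or> (\<exists>r. range r \<subseteq> unit_rats \<and> (\<forall>n\<ge>1. a \<in> Delta_tilde (initial r n))))
   \<and> (\<forall>n\<ge>1. \<forall>rs. length rs = n \<and> set rs \<subseteq> unit_rats \<longrightarrow>
        (\<forall>a \<in> {val (cycle (sw rs)) .. val (sw rs @- tw rs @- cycle (sw rs))}.
           chi a = val (tw rs @- cycle (sw rs)))
      \<and> (\<forall>a. 1/4 < a \<and> a < 1/2 \<and> a < val (cycle (sw rs)) \<longrightarrow>
           chi a < val (tw rs @- cycle (sw rs)))
      \<and> (\<forall>a. 1/4 < a \<and> a < 1/2 \<and> val (sw rs @- tw rs @- cycle (sw rs)) < a \<longrightarrow>
           chi a > val (tw rs @- cycle (sw rs))))
   \<and> (\<forall>a \<in> S_base. chi a = a + 1/4)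
   \<and> (\<forall>n\<ge>2. \<forall>rs. length rs = n - 1 \<and> set rs \<subseteq> unit_rats \<longrightarrow>
        (\<forall>a \<in> S_level rs.
           chi a = a + (1 - 1 / 2 ^ Qprod rs) * (fval (tw rs) - fval (sw rs))))
   \<and> (\<forall>a r. range r \<subseteq> unit_rats \<and> (\<forall>n\<ge>1. a \<in> Delta_tilde (initial r n)) \<longrightarrow>
        a = val (s_lim r) \<and> chi a = val (t_lim r))"
proof (intro conjI)
  show "\<forall>a::real. 1/4 < a \<and> a < 1/2 \<longrightarrow>
        (\<exists>n\<ge>1. \<exists>rs. length rs = n \<and> set rs \<subseteq> unit_rats \<and>
           a \<in> {val (cycle (sw rs)) .. val (sw rs @- tw rs @- cycle (sw rs))})
      \<or> a \<in> S_base
      \<or> (\<exists>n\<ge>2. \<exists>rs. length rs = n - 1 \<and> set rs \<subseteq> unit_rats \<and> a \<in> S_level rs)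
      \<or> (\<exists>r. range r \<subseteq> unit_rats \<and> (\<forall>n\<ge>1. a \<in> Delta_tilde (initial r n)))"
    (is "\<forall>a. _ \<longrightarrow> ?i a \<or> _ \<or> ?iii a \<or> ?iv a")
  proof (intro allI impI)
    fix a :: real assume a: "1/4 < a \<and> a < 1/2"
    have "?iv a" if neg: "\<not> ?i a" "a \<notin> S_base" "\<not> ?iii a"
    proof (rule category_exhaustive)
      fix rs :: "rat list" assume rs: "rs \<noteq> []" "set rs \<subseteq> unit_rats"
      then have "1 \<le> length rs" "2 \<le> length rs + 1" "length rs = length rs + 1 - 1"
        by (simp_all add: Suc_le_eq)
      then show "a \<notin> {val (cycle (sw rs)) .. val (sw rs @- tw rs @- cycle (sw rs))}" "a \<notin> S_level rs"
        using neg(1,3) rs(2) by blast+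
    qed (use a neg in auto)
    then show "?i a \<or> a \<in> S_base \<or> ?iii a \<or> ?iv a" by blast
  qed
next
  show "\<forall>n\<ge>1. \<forall>rs. length rs = n \<and> set rs \<subseteq> unit_rats \<longrightarrow>
        (\<forall>a \<in> {val (cycle (sw rs)) .. val (sw rs @- tw rs @- cycle (sw rs))}.
           chi a = val (tw rs @- cycle (sw rs)))
      \<and> (\<forall>a. 1/4 < a \<and> a < 1/2 \<and> a < val (cycle (sw rs)) \<longrightarrow>
           chi a < val (tw rs @- cycle (sw rs)))
      \<and> (\<forall>a. 1/4 < a \<and> a < 1/2 \<and> val (sw rs @- tw rs @- cycle (sw rs)) < a \<longrightarrow>
           chi a > val (tw rs @- cycle (sw rs)))"
  proof (intro allI impI)
    fix n rs assume "1 \<le> n" and *: "length rs = n \<and> set rs \<subseteq> unit_rats"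
    then have rs: "set rs \<subseteq> unit_rats" "rs \<noteq> []" by auto
    show "(\<forall>a \<in> {val (cycle (sw rs)) .. val (sw rs @- tw rs @- cycle (sw rs))}.
           chi a = val (tw rs @- cycle (sw rs)))
      \<and> (\<forall>a. 1/4 < a \<and> a < 1/2 \<and> a < val (cycle (sw rs)) \<longrightarrow>
           chi a < val (tw rs @- cycle (sw rs)))
      \<and> (\<forall>a. 1/4 < a \<and> a < 1/2 \<and> val (sw rs @- tw rs @- cycle (sw rs)) < a \<longrightarrow>
           chi a > val (tw rs @- cycle (sw rs)))"
      using chi_plateau[OF rs] chi_less_left[OF rs] chi_greater_right[OF rs]
      unfolding wsub_words[OF rs(1)] by simp
  qed
next
  show "\<forall>a \<in> S_base. chi a = a + 1/4"
  proof
    fix a assume a: "a \<in> S_base"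
    \<comment> \<open>The empty list has blocks 0 and 1 of length 1, and its range extends from 1/4
      to 1/2.\<close>
    have "chi a = a + (1 - 1 / 2 ^ Qprod []) * (fval (tw []) - fval (sw []))"
      using a by (intro chi_gap) (auto simp: S_base_def val_Stream)
    then show "chi a = a + 1/4" by (simp add: Qprod_def fval_def)
  qed
next
  show "\<forall>n\<ge>2. \<forall>rs. length rs = n - 1 \<and> set rs \<subseteq> unit_rats \<longrightarrow>
        (\<forall>a \<in> S_level rs.
           chi a = a + (1 - 1 / 2 ^ Qprod rs) * (fval (tw rs) - fval (sw rs)))"
  proof (intro allI impI ballI)
    fix n rs a
    assume "2 \<le> n" "length rs = n - 1 \<and> set rs \<subseteq> unit_rats" and a: "a \<in> S_level rs"
    then have rs: "set rs \<subseteq> unit_rats" "rs \<noteq> []" by auto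
    have a1: "val (wsub rs (False ## True ## constw False)) \<le> a" "a \<le> val (wsub rs (False ## constw True))"
      using a unfolding S_level_def Delta_tilde_def wsub_words[OF rs(1)] by auto
    have "val (wsub rs (constw False)) \<le> val (wsub rs (False ## True ## constw False))"
      by (intro wsub_val_mono[OF rs(1)] constw_least)
    then have a2: "1/4 < a" "a < 1/2" using a1 wsub_range[OF rs] by linarith+
    have "a \<notin> Delta (rs @ [r])" if "r \<in> unit_rats" for r
      using a that unfolding S_level_def by blast
    then show "chi a = a + (1 - 1 / 2 ^ Qprod rs) * (fval (tw rs) - fval (sw rs))"
      by (rule chi_gap[OF rs(1) a2 a1])
  qed
next
  show "\<forall>a r. range r \<subseteq> unit_rats \<and> (\<forall>n\<ge>1. a \<in> Delta_tilde (initial r n)) \<longrightarrow>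
        a = val (s_lim r) \<and> chi a = val (t_lim r)"
  proof (intro allI impI)
    fix a r assume *: "range r \<subseteq> unit_rats \<and> (\<forall>n\<ge>1. a \<in> Delta_tilde (initial r n))"
    have "a = val (s_lim r)" by (rule chi_limit(1)) (use * in blast)+
    moreover have "chi a = val (t_lim r)" by (rule chi_limit(2)) (use * in blast)+
    ultimately show "a = val (s_lim r) \<and> chi a = val (t_lim r)" by (rule conjI)
  qed
qed

end
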